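(* Let $\boldsymbol\lambda=(\lambda^0\mid\cdots\mid\lambda^{r-1})$ be an $r$-partite partition of size $n$ and write $\lambda^t=\langle1^{m_{t,1}},2^{m_{t,2}},\dots,n^{m_{t,n}}\rangle$ in frequency notation. Then the number of square roots in $G(r,1,n)$ (elements $\pi$ with $\pi^2=g$) of an element $g$ of cycle type $\boldsymbol\lambda$ is the coefficient of $(x_{0,1}^{m_{0,1}}\cdots x_{0,n}^{m_{0,n}})\cdots(x_{r-1,1}^{m_{r-1,1}}\cdots x_{r-1,n}^{m_{r-1,n}})$ in \[\begin{cases}\displaystyle\prod_{k\ge1}\prod_{t=0}^{r-1}\Big(\mathcal{D}(2kr\,x_{t,2k}^2)\,\mathcal{R}_{r(2k-1)}(x_{t,2k-1})\Big) & r\text{ odd},\\[0.3cm] \displaystyle\prod_{k\ge1}\Big(\prod_{t=0}^{r-1}\mathcal{D}(2kr\,x_{t,2k}^2)\prod_{\substack{0\le t\le r-1\\ t\text{ odd}}}\mathcal{D}((2k-1)r\,x_{t,2k-1}^2)\prod_{\substack{0\le t\le r-1\\ t\text{ even}}}\mathcal{R}_{\frac{r(2k-1)}{4}}(2x_{t,2k-1})\Big) & r\text{ even}.\end{cases}\] Therefore the generating function in $n$ of the sum, over all conjugacy classes of $G(r,1,n)$, of the number of square roots of a representative of the class is \[\begin{cases}\displaystyle\prod_{k\ge1}\Big(\mathcal{D}(2kr\,x^{4k})^r\,\mathcal{R}_{r(2k-1)}(x^{2k-1})^r\Big) & r\text{ odd},\\[0.3cm] \displaystyle\prod_{k\ge1}\Big(\mathcal{D}(2kr\,x^{4k})^r\,\mathcal{D}((2k-1)r\,x^{4k-2})^{r/2}\,\mathcal{R}_{\frac{r(2k-1)}{4}}(2x^{2k-1})^{r/2}\Big)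 & r\text{ even}.\end{cases}\]
   Context: Let $\mathbb{Z}_r$ be the cyclic group of order $r$. $G(r,1,n)=\{(z_1,\dots,z_n;\sigma):z_i\in\mathbb{Z}_r,\sigma\in S_n\}$ with product $(z;\sigma)(z';\sigma')=(z_1+z'_{\sigma^{-1}(1)},\dots,z_n+z'_{\sigma^{-1}(n)};\sigma\sigma')$. The color of a cycle $(u_1,\dots,u_\ell)$ of $\sigma$ is $z_{u_1}+\cdots+z_{u_\ell}$; the cycle type of $(z;\sigma)$ is $(\lambda^0\mid\cdots\mid\lambda^{r-1})$ with $\lambda^j$ the partition of lengths of color-$j$ cycles; conjugacy classes are exactly the sets of elements with a given cycle type. In frequency notation, $m_{t,j}$ is the number of parts of $\lambda^t$ equal to $j$. $x$ and $x_{t,j}$ are commuting indeterminates. $(2k-1)!!=(2k-1)(2k-3)\cdots1$, $(-1)!!=1$; $\mathcal{D}(x)=\sum_{n\ge0}(2n-1)!!x^n$; for a parameter $c$, $\mathcal{R}_c(x)=\sum_{n\ge0}o_c(n)x^n$ with $o_c(n)=\sum_{k=0}^{\lfloor n/2\rfloor}\binom{n}{2k}(2k-1)!!\,c^k$. *)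

theory Defs
  imports "HOL-Library.Poly_Mapping" "HOL-Computational_Algebra.Formal_Power_Series"
    "HOL-Combinatorics.Permutations"
begin

text \<open>dfact k = (2k-1)!! = (2k-1)(2k-3)...1, with dfact 0 = (-1)!! = 1.\<close>
definition dfact :: "nat \<Rightarrow> nat" where
  "dfact k = (\<Prod>i<k. 2 * i + 1)"

definition fpsD :: "real fps" where
  "fpsD = Abs_fps (\<lambda>n. real (dfact n))"

definition oc :: "real \<Rightarrow> nat \<Rightarrow> real" where
  "oc c n = (\<Sum>k\<le>n div 2. real (n choose (2 * k)) * real (dfact k) * c ^ k)"

definition fpsR :: "real \<Rightarrow> real fps" where
  "fpsR c = Abs_fps (oc c)"

text \<open>Elements (z;sigma): sigma a permutation of {1..n}, z : {1..n} -> Z_r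
  (Z_r = {0..<r} with addition mod r; z is 0 outside {1..n}).\<close>
type_synonym gelem = "(nat \<Rightarrow> nat) \<times> (nat \<Rightarrow> nat)"

definition Gr :: "nat \<Rightarrow> nat \<Rightarrow> gelem set" where
  "Gr r n = {(z, \<sigma>). \<sigma> permutes {1..n} \<and> (\<forall>i\<in>{1..n}. z i < r) \<and> (\<forall>i. i \<notin> {1..n} \<longrightarrow> z i = 0)}"

definition Gmult :: "nat \<Rightarrow> nat \<Rightarrow> gelem \<Rightarrow> gelem \<Rightarrow> gelem" where
  "Gmult r n g h = (case g of (z, \<sigma>) \<Rightarrow> case h of (z', \<sigma>') \<Rightarrow>
      ((\<lambda>i. if i \<in> {1..n} then (z i + z' (inv \<sigma> i)) mod r else 0), \<sigma> \<circ> \<sigma>'))"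

definition sqrt_count :: "nat \<Rightarrow> nat \<Rightarrow> gelem \<Rightarrow> nat" where
  "sqrt_count r n g = card {p \<in> Gr r n. Gmult r n p p = g}"

definition cycle_of :: "(nat \<Rightarrow> nat) \<Rightarrow> nat \<Rightarrow> nat set" where
  "cycle_of \<sigma> i = range (\<lambda>k. (\<sigma> ^^ k) i)"

definition cycles :: "(nat \<Rightarrow> nat) \<Rightarrow> nat \<Rightarrow> nat set set" where
  "cycles \<sigma> n = cycle_of \<sigma> ` {1..n}"

definition cycle_color :: "nat \<Rightarrow> (nat \<Rightarrow> nat) \<Rightarrow> nat set \<Rightarrow> nat" where
  "cycle_color r z c = (\<Sum>u\<in>c. z u) mod r"

definition cyc_mult :: "nat \<Rightarrow> nat \<Rightarrow> gelem \<Rightarrow> nat \<Rightarrow> nat \<Rightarrow> nat" where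
  "cyc_mult r n g t j = card {c \<in> cycles (snd g) n. card c = j \<and> cycle_color r (fst g) c = t}"

text \<open>The monomial prod_{t,j} x_{t,j}^{m_{t,j}}; variables x_{t,j} are indexed by pairs (t,j).\<close>
definition cycle_monomial :: "nat \<Rightarrow> nat \<Rightarrow> gelem \<Rightarrow> (nat \<times> nat) \<Rightarrow>\<^sub>0 nat" where
  "cycle_monomial r n g = Abs_poly_mapping
     (\<lambda>(t, j). if t < r \<and> j \<in> {1..n} then cyc_mult r n g t j else 0)"

type_synonym mps = "((nat \<times> nat) \<Rightarrow>\<^sub>0 nat) \<Rightarrow> real"

definition mps_one :: mps where
  "mps_one m = (if m = 0 then 1 else 0)"

definition mps_mult :: "mps \<Rightarrow> mps \<Rightarrow> mps" where
  "mps_mult f g m = (\<Sum>p\<in>{p. fst p + snd p = m}. f (fst p) * g (snd p))"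

fun mps_listprod :: "mps list \<Rightarrow> mps" where
  "mps_listprod [] = mps_one"
| "mps_listprod (f # fs) = mps_mult f (mps_listprod fs)"

text \<open>mps_sub f a v e is the series f(a * x_v^e) (for e > 0).\<close>
definition mps_sub :: "real fps \<Rightarrow> real \<Rightarrow> nat \<times> nat \<Rightarrow> nat \<Rightarrow> mps" where
  "mps_sub f a v e m =
     (if m = Poly_Mapping.single v (Poly_Mapping.lookup m v) \<and> e dvd Poly_Mapping.lookup m v
      then fps_nth f (Poly_Mapping.lookup m v div e) * a ^ (Poly_Mapping.lookup m v div e) else 0)"

definition factors1 :: "nat \<Rightarrow> nat \<Rightarrow> mps list" where
  "factors1 r k =
    (if odd r then
       concat (map (\<lambda>t. [mps_sub fpsD (real (2 * k * r)) (t, 2 * k) 2,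
                         mps_sub (fpsR (real (r * (2 * k - 1)))) 1 (t, 2 * k - 1) 1]) [0..<r])
     else
       map (\<lambda>t. mps_sub fpsD (real (2 * k * r)) (t, 2 * k) 2) [0..<r]
       @ map (\<lambda>t. mps_sub fpsD (real ((2 * k - 1) * r)) (t, 2 * k - 1) 2) (filter odd [0..<r])
       @ map (\<lambda>t. mps_sub (fpsR (real (r * (2 * k - 1)) / 4)) 2 (t, 2 * k - 1) 1)
             (filter even [0..<r]))"

definition partial1 :: "nat \<Rightarrow> nat \<Rightarrow> mps" where
  "partial1 r K = mps_listprod (concat (map (factors1 r) [1..<K + 1]))"

definition conj_classes :: "nat \<Rightarrow> nat \<Rightarrow> gelem set set" where
  "conj_classes r n = {{g' \<in> Gr r n. \<exists>h\<in>Gr r n. Gmult r n h g = Gmult r n g' h} | g. g \<in> Gr r n}"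

definition class_sum :: "nat \<Rightarrow> nat \<Rightarrow> real" where
  "class_sum r n = (\<Sum>C\<in>conj_classes r n. real (sqrt_count r n (SOME g. g \<in> C)))"

definition gen_factor :: "nat \<Rightarrow> nat \<Rightarrow> real fps" where
  "gen_factor r k =
    (if odd r then
       (fpsD oo (fps_const (real (2 * k * r)) * fps_X ^ (4 * k))) ^ r
       * (fpsR (real (r * (2 * k - 1))) oo fps_X ^ (2 * k - 1)) ^ r
     else
       (fpsD oo (fps_const (real (2 * k * r)) * fps_X ^ (4 * k))) ^ r
       * (fpsD oo (fps_const (real ((2 * k - 1) * r)) * fps_X ^ (4 * k - 2))) ^ (r div 2)
       * (fpsR (real (r * (2 * k - 1)) / 4) oo (fps_const 2 * fps_X ^ (2 * k - 1))) ^ (r div 2))"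

end

theory Submission
  imports Defs "HOL-Combinatorics.Cycles" "HOL-Number_Theory.Cong"
begin

text \<open>
  A square root \<open>(z; \<sigma>)\<close> of \<open>(w; \<tau>)\<close> permutes the cycles of \<open>\<tau>\<close>, and it either fixes a given cycle
  \<open>C\<close> or swaps it with another cycle of the same length \<open>j\<close> and colour \<open>t\<close>. In the first case \<open>j\<close> is
  odd, \<open>\<sigma>\<close> is determined on \<open>C\<close>, and the colours are determined by an \<open>s\<close> with \<open>2s = B\<close> in \<open>\<int>\<^sub>r\<close>, where
  \<open>B\<close> has the parity of \<open>t\<close> if \<open>r\<close> is even; in the second case there are \<open>j\<close> choices for \<open>\<sigma>\<close> and \<open>r\<close>
  for the colours. Splitting off \<open>C\<close> therefore gives, independently for each type \<open>(t, j)\<close>, a recursion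
  \<open>W (m + 1) = \<alpha> W m + m j r W (m - 1)\<close> in the multiplicity \<open>m\<close>, which the coefficients of the
  factors \<open>\<D>\<close> and \<open>\<R>\<close> also satisfy. For the class sum, conjugacy classes correspond bijectively
  to the multiplicity functions \<open>m\<close> on types with \<open>\<Sum> j m(t, j) = n\<close>.
\<close>

subsection \<open>Cycles of a permutation\<close>

text \<open>Removing cycles leaves \<open>{1..n}\<close> at once, so roots are counted on arbitrary
  unions of cycles of \<tau>. The colours obey z(\<sigma> i) + z i = w(\<sigma> i); one turn around
  a cycle of \<sigma> of length L takes a starting value s to (-1)^L s plus an alternating sum B of
  values of w. For odd L this closes up iff 2s = B, and modulo 2 the signs in B disappear, which
  leaves the colour of C. On a swapped pair \<sigma> is a single cycle of even length that
  alternates between the two, so s cancels and stays free, and closing up says that the two colours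
  agree.

  The constants come from scaling: for \<alpha> nonzero, W(m+1) = \<alpha> W(m) + m \<beta> W(m-1)
  with W(0) = 1 is solved by \<alpha>^m o_c(m) with c = \<beta>/\<alpha>^2. With \<beta> = jr,
  \<alpha> = 1 gives c = jr, and \<alpha> = 2 gives c = jr/4 and the argument 2x. For \<alpha> = 0
  every cycle must be paired, hence D in the square of the variable.\<close>

lemma self_in_cycle_of: "a \<in> cycle_of \<tau> a"
  unfolding cycle_of_def using rangeI[of "\<lambda>k. (\<tau> ^^ k) a" 0] by simp

lemma funpow_in_cycle_of: "(\<tau> ^^ k) a \<in> cycle_of \<tau> a"
  unfolding cycle_of_def by simp

lemma funpow_add_apply: "((f::'a \<Rightarrow> 'a) ^^ (m + n)) x = (f ^^ m) ((f ^^ n) x)"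
  by (simp add: funpow_add)

lemma least_power_pos:
  assumes "\<tau> permutes S" "finite S"
  shows "least_power \<tau> a > 0" "(\<tau> ^^ least_power \<tau> a) a = a"
  using least_power_of_permutation[of \<tau> a] permutes_imp_permutation[OF assms(2,1)] by auto

lemma funpow_mod_least_power:
  assumes "\<tau> permutes S" "finite S"
  shows "(\<tau> ^^ (i mod least_power \<tau> a)) a = (\<tau> ^^ i) a"
proof -
  let ?L = "least_power \<tau> a"
  have "(\<tau> ^^ i) a = (\<tau> ^^ (i mod ?L)) ((\<tau> ^^ (?L * (i div ?L))) a)"
    by (subst funpow_add_apply[symmetric]) simp
  also have "(\<tau> ^^ (?L * (i div ?L))) a = a"
    using least_power_dvd[OF permutes_imp_permutation[OF assms(2,1)], of a "?L * (i div ?L)"] by simp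
  finally show ?thesis by simp
qed

lemma funpow_eq_iff_least_power:
  assumes "\<tau> permutes S" "finite S"
  shows "(\<tau> ^^ i) a = (\<tau> ^^ j) a \<longleftrightarrow> i mod least_power \<tau> a = j mod least_power \<tau> a"
proof -
  let ?L = "least_power \<tau> a"
  have *: "i' = j'" if "i' \<le> j'" "j' < ?L" "(\<tau> ^^ i') a = (\<tau> ^^ j') a" for i' j'
  proof -
    have "inj (\<tau> ^^ i')" using assms(1) by (simp add: permutes_inj)
    moreover have "(\<tau> ^^ i') ((\<tau> ^^ (j' - i')) a) = (\<tau> ^^ i') a"
      using that(1,3) by (subst funpow_add_apply[symmetric]) simp
    ultimately have "(\<tau> ^^ (j' - i')) a = a" by (simp add: inj_eq)
    then have "?L dvd j' - i'"
      using least_power_dvd[OF permutes_imp_permutation[OF assms(2,1)]] by blast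
    then show ?thesis using that(1,2) nat_dvd_not_less[of "j' - i'" ?L] by linarith
  qed
  have "i mod ?L = j mod ?L" if "(\<tau> ^^ (i mod ?L)) a = (\<tau> ^^ (j mod ?L)) a"
    using *[of "i mod ?L" "j mod ?L"] *[of "j mod ?L" "i mod ?L"] that
      mod_less_divisor[OF least_power_pos(1)[OF assms]] by (cases "i mod ?L \<le> j mod ?L") auto
  then show ?thesis
    using funpow_mod_least_power[OF assms, of i a] funpow_mod_least_power[OF assms, of j a] by auto
qed

lemma bij_betw_funpow_cycle_of:
  assumes "\<tau> permutes S" "finite S"
  shows "bij_betw (\<lambda>k. (\<tau> ^^ k) a) {..<least_power \<tau> a} (cycle_of \<tau> a)"
proof (rule bij_betw_imageI)
  show "inj_on (\<lambda>k. (\<tau> ^^ k) a) {..<least_power \<tau> a}"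
    by (auto intro!: inj_onI simp: funpow_eq_iff_least_power[OF assms])
  show "(\<lambda>k. (\<tau> ^^ k) a) ` {..<least_power \<tau> a} = cycle_of \<tau> a"
  proof
    show "cycle_of \<tau> a \<subseteq> (\<lambda>k. (\<tau> ^^ k) a) ` {..<least_power \<tau> a}"
    proof
      fix x assume "x \<in> cycle_of \<tau> a"
      then obtain k where "x = (\<tau> ^^ k) a" by (auto simp: cycle_of_def)
      then have "x = (\<tau> ^^ (k mod least_power \<tau> a)) a"
        by (simp add: funpow_mod_least_power[OF assms])
      then show "x \<in> (\<lambda>k. (\<tau> ^^ k) a) ` {..<least_power \<tau> a}"
        using least_power_pos[OF assms] by auto
    qed
  qed (auto simp: cycle_of_def)
qed

lemma card_cycle_of:
  assumes "\<tau> permutes S" "finite S"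
  shows "card (cycle_of \<tau> a) = least_power \<tau> a"
  using bij_betw_same_card[OF bij_betw_funpow_cycle_of[OF assms]] by simp

lemma finite_cycle_of:
  assumes "\<tau> permutes S" "finite S"
  shows "finite (cycle_of \<tau> a)"
  using bij_betw_finite[OF bij_betw_funpow_cycle_of[OF assms]] by simp

lemma card_cycle_of_pos:
  assumes "\<tau> permutes S" "finite S"
  shows "card (cycle_of \<tau> a) > 0"
  using card_cycle_of[OF assms] least_power_pos[OF assms] by simp

lemma funpow_eq_iff_card:
  assumes "\<tau> permutes S" "finite S"
  shows "(\<tau> ^^ i) a = (\<tau> ^^ j) a \<longleftrightarrow> i mod card (cycle_of \<tau> a) = j mod card (cycle_of \<tau> a)"
  by (simp add: card_cycle_of[OF assms] funpow_eq_iff_least_power[OF assms])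

lemma funpow_card:
  assumes "\<tau> permutes S" "finite S"
  shows "(\<tau> ^^ card (cycle_of \<tau> a)) a = a"
  by (simp add: card_cycle_of[OF assms] least_power_pos[OF assms])

lemma sum_cycle_of:
  assumes "\<tau> permutes S" "finite S"
  shows "(\<Sum>x\<in>cycle_of \<tau> a. f x) = (\<Sum>k<card (cycle_of \<tau> a). f ((\<tau> ^^ k) a))"
  using sum.reindex_bij_betw[OF bij_betw_funpow_cycle_of[OF assms], of f a]
  by (simp add: card_cycle_of[OF assms])

text \<open>The colour equations read \<open>w\<close> at the image of a point, so sums along a
  cycle start at the first iterate. The cycle closes up, so this shift by one changes
  nothing.\<close>

lemma sum_cycle_of_Suc:
  fixes f :: "nat \<Rightarrow> 'a::comm_monoid_add"
  assumes "\<tau> permutes S" "finite S"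
  shows "(\<Sum>x\<in>cycle_of \<tau> a. f x) = (\<Sum>k<card (cycle_of \<tau> a). f ((\<tau> ^^ Suc k) a))"
proof -
  obtain L where L: "card (cycle_of \<tau> a) = Suc L"
    using card_cycle_of_pos[OF assms, of a] gr0_implies_Suc by blast
  have "f ((\<tau> ^^ Suc L) a) = f a" using funpow_card[OF assms, of a] by (simp only: L)
  then show ?thesis
    unfolding sum_cycle_of[OF assms] L
    by (subst sum.lessThan_Suc_shift, subst sum.lessThan_Suc) (simp add: add.commute)
qed

lemma cycle_of_subset:
  assumes "\<tau> permutes S" "a \<in> S"
  shows "cycle_of \<tau> a \<subseteq> S"
  unfolding cycle_of_def using permutes_in_funpow_image[OF assms] by auto

lemma cycle_of_eq:
  assumes "\<tau> permutes S" "finite S" "x \<in> cycle_of \<tau> a"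
  shows "cycle_of \<tau> x = cycle_of \<tau> a"
proof
  obtain k where k: "x = (\<tau> ^^ k) a" using assms(3) by (auto simp: cycle_of_def)
  show "cycle_of \<tau> x \<subseteq> cycle_of \<tau> a"
    unfolding cycle_of_def k by (auto simp: funpow_add_apply[symmetric])
  have "(\<tau> ^^ i) a \<in> cycle_of \<tau> x" for i
  proof -
    let ?L = "card (cycle_of \<tau> a)"
    have "(\<tau> ^^ i) a = (\<tau> ^^ (i + k * ?L)) a"
      by (simp add: funpow_eq_iff_card[OF assms(1,2)])
    \<comment> \<open>\<open>cycle_of\<close> uses forward iterates only, so going back by
      \<open>k\<close> steps from \<open>x\<close> is done by going forward: \<open>k\<close> full
      turns minus \<open>k\<close> steps, a natural number because \<open>?L\<close> is
      positive.\<close>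
    also have "i + k * ?L = (i + (k * ?L - k)) + k"
      using card_cycle_of_pos[OF assms(1,2), of a] by (cases ?L) auto
    also have "(\<tau> ^^ ((i + (k * ?L - k)) + k)) a \<in> cycle_of \<tau> x"
      unfolding k funpow_add_apply[where m = "i + (k * ?L - k)"] by (rule funpow_in_cycle_of)
    finally show ?thesis .
  qed
  then show "cycle_of \<tau> a \<subseteq> cycle_of \<tau> x" by (auto simp: cycle_of_def)
qed

lemma cycle_of_disjoint:
  assumes "\<tau> permutes S" "finite S" "cycle_of \<tau> a \<noteq> cycle_of \<tau> b"
  shows "cycle_of \<tau> a \<inter> cycle_of \<tau> b = {}"
  using cycle_of_eq[OF assms(1,2)] assms(3) by (metis disjoint_iff)

lemma permutes_image_cycle_of:
  assumes "\<tau> permutes S" "finite S"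
  shows "\<tau> ` cycle_of \<tau> a = cycle_of \<tau> a"
proof (rule card_subset_eq[OF finite_cycle_of[OF assms]])
  show "\<tau> ` cycle_of \<tau> a \<subseteq> cycle_of \<tau> a"
    using funpow_in_cycle_of[of "Suc _" \<tau> a] by (auto simp: cycle_of_def)
  show "card (\<tau> ` cycle_of \<tau> a) = card (cycle_of \<tau> a)"
    by (rule card_image) (use permutes_inj[OF assms(1)] in \<open>auto simp: inj_on_def inj_def\<close>)
qed

section \<open>Functions prescribed along an orbit\<close>

lemma periodic_mod_eq:
  assumes "\<And>k. f (k + L) = f k" and "i mod L = j mod (L::nat)"
  shows "f i = f j"
proof -
  have mult: "f (k + m * L) = f k" for k m
    by (induction m) (simp_all add: assms(1) add.assoc[symmetric] add.commute[of L])
  have "f k = f (k mod L)" for k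
    using mult[of "k mod L" "k div L"] by simp
  then show ?thesis using assms(2) by metis
qed

text \<open>Well-definedness in the form needed for maps on cycles: values are prescribed by
  position, and they descend to points if they agree whenever two positions give the same
  point.\<close>

lemma exists_factor:
  assumes "\<And>i j. i \<in> I \<Longrightarrow> j \<in> I \<Longrightarrow> g i = g j \<Longrightarrow> f i = f j"
  shows "\<exists>\<phi>. \<forall>i\<in>I. \<phi> (g i) = f i"
proof (intro exI ballI)
  fix i assume "i \<in> I"
  then have "(SOME j. j \<in> I \<and> g j = g i) \<in> I \<and> g (SOME j. j \<in> I \<and> g j = g i) = g i"
    by (intro someI[of "\<lambda>j. j \<in> I \<and> g j = g i" i]) simp
  with \<open>i \<in> I\<close> show "(\<lambda>x. f (SOME j. j \<in> I \<and> g j = x)) (g i) = f i"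
    by (intro assms) simp_all
qed

lemma exists_fun_on_cycle:
  assumes "\<tau> permutes S" "finite S"
    and "\<And>k. f (k + card (cycle_of \<tau> a)) = f k"
  shows "\<exists>\<phi>. \<forall>k. \<phi> ((\<tau> ^^ k) a) = f k"
proof -
  have "f i = f j" if "(\<tau> ^^ i) a = (\<tau> ^^ j) a" for i j
    using that unfolding funpow_eq_iff_card[OF assms(1,2)] by (rule periodic_mod_eq[of f, OF assms(3)])
  then have "\<exists>\<phi>. \<forall>k\<in>UNIV. \<phi> ((\<tau> ^^ k) a) = f k" by (rule exists_factor)
  then show ?thesis by simp
qed

subsection \<open>Colourings along a cycle\<close>

text \<open>The solution of y(k+1) = b(k) - y(k) with y(0) = 0, which is the recursion that the
  colour equation imposes along a cycle. It is an integer because the subtraction may go below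
  0.\<close>

definition alt_sum :: "(nat \<Rightarrow> nat) \<Rightarrow> nat \<Rightarrow> int" where
  "alt_sum b k = (\<Sum>i<k. (-1) ^ (k - Suc i) * int (b i))"

lemma alt_sum_0 [simp]: "alt_sum b 0 = 0"
  by (simp add: alt_sum_def)

lemma alt_sum_Suc: "alt_sum b (Suc k) = int (b k) - alt_sum b k"
proof -
  have "(\<Sum>i<k. (-1) ^ (Suc k - Suc i) * int (b i)) = (\<Sum>i<k. - ((-1) ^ (k - Suc i) * int (b i)))"
  proof (rule sum.cong[OF refl])
    fix i assume "i \<in> {..<k}"
    then have "Suc k - Suc i = Suc (k - Suc i)" by auto
    then show "(-1) ^ (Suc k - Suc i) * int (b i) = - ((-1) ^ (k - Suc i) * int (b i))"
      by simp
  qed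
  then show ?thesis by (simp add: alt_sum_def sum_negf)
qed

text \<open>Signs are invisible modulo 2. For even \<open>r\<close> this is how the solvability of
  2s = B comes to depend only on the parity of the colour of the cycle.\<close>

lemma even_alt_sum_iff: "even (alt_sum b k) \<longleftrightarrow> even (\<Sum>i<k. b i)"
  by (induction k) (auto simp: alt_sum_Suc)

text \<open>For a swapped pair of cycles: the even and the odd positions lie in different cycles, so
  the alternating sum becomes a difference of two colour sums.\<close>

lemma alt_sum_double:
  "alt_sum b (2 * k) = (\<Sum>i<k. int (b (2 * i + 1))) - (\<Sum>i<k. int (b (2 * i)))"
  by (induction k) (simp_all add: alt_sum_Suc)

text \<open>Colour part of the equation p p = (w; \<tau>) for a fixed permutation part \<sigma>. The
  product has z i + z (\<sigma>^-1 i) at i; writing it at \<sigma> i removes the inverse. The value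
  0 off \<open>A\<close> makes each colouring a unique function and the set finite.\<close>

definition colourings :: "nat \<Rightarrow> (nat \<Rightarrow> nat) \<Rightarrow> (nat \<Rightarrow> nat) \<Rightarrow> nat set \<Rightarrow> (nat \<Rightarrow> nat) set" where
  "colourings r w \<sigma> A = {z. (\<forall>i\<in>A. z i < r) \<and> (\<forall>i. i \<notin> A \<longrightarrow> z i = 0) \<and>
     (\<forall>i\<in>A. (z (\<sigma> i) + z i) mod r = w (\<sigma> i))}"

text \<open>The equation z (\<sigma> i) + z i = w (\<sigma> i) determines z along a cycle of \<sigma> from its value s
  at one point; going once around the cycle leaves a single condition on s.\<close>

lemma card_colourings_cycle:
  fixes r :: nat
  assumes \<sigma>: "\<sigma> permutes A" "finite A" and A: "A = cycle_of \<sigma> a"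
    and w: "\<And>i. i \<in> A \<Longrightarrow> w i < r"
  shows "card (colourings r w \<sigma> A) =
    card {s. s < r \<and> [(-1) ^ card A * int s + alt_sum (\<lambda>k. w ((\<sigma> ^^ Suc k) a)) (card A) = int s] (mod int r)}"
    (is "_ = card ?T")
proof -
  define b where "b = (\<lambda>k. w ((\<sigma> ^^ Suc k) a))"
  define y where "y = (\<lambda>s k. (-1) ^ k * int s + alt_sum b k)"
  let ?L = "card A"
  have r: "r > 0" using w[of a] self_in_cycle_of[of a \<sigma>] A by fastforce
  have y0: "y s 0 = int s" for s by (simp add: y_def)
  have ySuc: "y s (Suc k) = int (b k) - y s k" for s k
    by (simp add: y_def alt_sum_Suc)
  have in_A: "(\<sigma> ^^ k) a \<in> A" for k unfolding A by (rule funpow_in_cycle_of)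
  have A_ex: "\<exists>k. i = (\<sigma> ^^ k) a" if "i \<in> A" for i
    using that unfolding A by (auto simp: cycle_of_def)
  have period: "(\<sigma> ^^ ?L) a = a" using funpow_card[OF \<sigma>, of a] by (simp add: A[symmetric])
  have bper: "b (k + ?L) = b k" for k
    unfolding b_def using funpow_add_apply[of "Suc k" ?L \<sigma> a] by (simp add: period)
  have zy: "[int (z ((\<sigma> ^^ k) a)) = y (z a) k] (mod int r)" if z: "z \<in> colourings r w \<sigma> A" for z k
  proof (induction k)
    case (Suc k)
    have "(z (\<sigma> ((\<sigma> ^^ k) a)) + z ((\<sigma> ^^ k) a)) mod r = b k"
      using z in_A[of k] by (simp add: colourings_def b_def)
    then have "int (z ((\<sigma> ^^ Suc k) a) + z ((\<sigma> ^^ k) a)) mod int r = int (b k)"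
      by (metis (no_types) zmod_int funpow.simps(2) o_apply)
    then have "[int (z ((\<sigma> ^^ Suc k) a)) + int (z ((\<sigma> ^^ k) a)) = int (b k)] (mod int r)"
      by (metis cong_def mod_mod_trivial of_nat_add)
    from cong_diff[OF this Suc] show ?case by (simp add: ySuc)
  qed (simp add: y0)
  have "bij_betw (\<lambda>z. z a) (colourings r w \<sigma> A) ?T"
  proof (rule bij_betw_imageI)
    show "inj_on (\<lambda>z. z a) (colourings r w \<sigma> A)"
    proof (rule inj_onI, rule ext)
      fix z z' i assume z: "z \<in> colourings r w \<sigma> A" and z': "z' \<in> colourings r w \<sigma> A" and e: "z a = z' a"
      show "z i = z' i"
      proof (cases "i \<in> A")
        case True
        then obtain k where k: "i = (\<sigma> ^^ k) a" using A_ex by blast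
        have "[int (z i) = int (z' i)] (mod int r)"
          using zy[OF z, of k] zy[OF z', of k] unfolding k e by (meson cong_sym cong_trans)
        then have "[z i = z' i] (mod r)" by (simp add: cong_int_iff)
        moreover have "z i < r" "z' i < r" using z z' True by (auto simp: colourings_def)
        ultimately show ?thesis by (simp add: cong_def)
      qed (use z z' in \<open>auto simp: colourings_def\<close>)
    qed
    show "(\<lambda>z. z a) ` colourings r w \<sigma> A = ?T"
    proof
      show "(\<lambda>z. z a) ` colourings r w \<sigma> A \<subseteq> ?T"
      proof clarsimp
        fix z assume z: "z \<in> colourings r w \<sigma> A"
        have "[y (z a) ?L = int (z a)] (mod int r)"
          using zy[OF z, of ?L] by (simp add: period cong_sym)
        moreover have "z a < r" using z in_A[of 0] by (simp add: colourings_def)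
        ultimately show "z a < r \<and> [(-1) ^ card A * int (z a) + alt_sum (\<lambda>k. w (\<sigma> ((\<sigma> ^^ k) a))) (card A) = int (z a)] (mod int r)"
          by (simp add: y_def b_def)
      qed
      show "?T \<subseteq> (\<lambda>z. z a) ` colourings r w \<sigma> A"
      proof
        fix s assume "s \<in> ?T"
        then have s: "s < r" "[y s ?L = int s] (mod int r)" by (auto simp: y_def b_def)
        \<comment> \<open>The closing condition at \<open>?L\<close> propagates through the
          recursion, because \<open>b\<close> is periodic as well. Hence \<open>y s\<close> depends
          modulo \<open>r\<close> only on the point of the cycle, and every admissible
          \<open>s\<close> extends to a colouring.\<close>
        have yper: "[y s (k + ?L) = y s k] (mod int r)" for k
        proof (induction k)
          case (Suc k)
          then show ?case by (simp add: ySuc bper cong_diff)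
        qed (use s in \<open>simp add: y0\<close>)
        have "\<exists>\<phi>. \<forall>k. \<phi> ((\<sigma> ^^ k) a) = nat (y s k mod int r)"
          by (rule exists_fun_on_cycle[OF \<sigma>])
            (use yper in \<open>simp add: A[symmetric] cong_def\<close>)
        then obtain \<phi> where \<phi>: "\<And>k. \<phi> ((\<sigma> ^^ k) a) = nat (y s k mod int r)" by blast
        define z where "z = (\<lambda>i. if i \<in> A then \<phi> i else 0)"
        have zk: "int (z ((\<sigma> ^^ k) a)) = y s k mod int r" for k
          using in_A[of k] r by (simp add: z_def \<phi>)
        have "z \<in> colourings r w \<sigma> A"
          unfolding colourings_def
        proof (intro CollectI conjI ballI allI impI)
          fix i assume "i \<in> A"
          then obtain k where k: "i = (\<sigma> ^^ k) a" using A_ex by blast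
          have "int (z i) < int r" unfolding k zk using r by simp
          then show "z i < r" by simp
          have "int ((z (\<sigma> i) + z i) mod r) = (y s (Suc k) mod int r + y s k mod int r) mod int r"
            using zk[of "Suc k"] zk[of k] by (simp add: k zmod_int)
          also have "\<dots> = int (b k) mod int r" by (simp add: ySuc mod_add_eq)
          also have "\<dots> = int (w (\<sigma> i))" using w[OF in_A[of "Suc k"]] by (simp add: b_def k)
          finally show "(z (\<sigma> i) + z i) mod r = w (\<sigma> i)" by simp
        qed (auto simp: z_def)
        moreover have "z a = s" using zk[of 0] s(1) by (simp add: y0)
        ultimately show "s \<in> (\<lambda>z. z a) ` colourings r w \<sigma> A" by blast
      qed
    qed
  qed
  then show ?thesis by (rule bij_betw_same_card)
qed

section \<open>Solving 2s = B modulo r\<close>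

lemma card_halves_odd:
  fixes r :: nat and B :: int
  assumes "odd r"
  shows "card {s. s < r \<and> [2 * int s = B] (mod int r)} = 1"
proof -
  \<comment> \<open>(r + 1)/2 is the inverse of 2 modulo an odd r.\<close>
  define s where "s = nat ((B * ((int r + 1) div 2)) mod int r)"
  have r: "r > 0" using assms by (cases r) auto
  have s: "int s = (B * ((int r + 1) div 2)) mod int r" using r by (simp add: s_def)
  have two: "2 * ((int r + 1) div 2) = int r + 1"
    by (rule dvd_mult_div_cancel) (use assms in simp)
  have "[2 * int s = 2 * (B * ((int r + 1) div 2))] (mod int r)"
    unfolding s by (simp add: cong_def mod_mult_right_eq)
  also have "2 * (B * ((int r + 1) div 2)) = B + B * int r"
    using two by (simp add: mult.left_commute[of 2] algebra_simps)
  also have "[B + B * int r = B] (mod int r)" by (simp add: cong_def)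
  finally have sB: "[2 * int s = B] (mod int r)" .
  have "s < r" using s r by (metis of_nat_less_iff pos_mod_bound of_nat_0_less_iff)
  have "{s. s < r \<and> [2 * int s = B] (mod int r)} = {s}"
  proof (intro set_eqI iffI)
    fix x assume "x \<in> {s. s < r \<and> [2 * int s = B] (mod int r)}"
    then have x: "x < r" "[2 * int x = B] (mod int r)" by auto
    have "[2 * int x = 2 * int s] (mod int r)" using x(2) sB by (meson cong_sym cong_trans)
    then have "[int x = int s] (mod int r)"
      using assms by (simp add: cong_mult_lcancel)
    then have "[x = s] (mod r)" by (simp add: cong_int_iff)
    then show "x \<in> {s}" using x(1) \<open>s < r\<close> by (simp add: cong_def)
  qed (use sB \<open>s < r\<close> in auto)
  then show ?thesis by simp
qed

lemma card_halves_even: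
  fixes r :: nat and B :: int
  assumes "even r" "r > 0"
  shows "card {s. s < r \<and> [2 * int s = B] (mod int r)} = (if even B then 2 else 0)"
proof (cases "even B")
  case True
  then obtain C where C: "B = 2 * C" by blast
  obtain h where h: "r = 2 * h" using assms by blast
  have h0: "h > 0" using h assms by simp
  \<comment> \<open>Dividing 2s = 2C by 2 modulo r = 2h leaves s = C modulo h, and a residue modulo
    h has two lifts below 2h: \<open>c\<close> and \<open>c + h\<close>.\<close>
  define c where "c = nat (C mod int h)"
  have c: "int c = C mod int h" "c < h" using h0 by (simp_all add: c_def nat_less_iff)
  have iff: "[2 * int s = B] (mod int r) \<longleftrightarrow> s mod h = c" for s
  proof -
    have "[2 * int s = B] (mod int r) \<longleftrightarrow> int s mod int h = C mod int h"
      unfolding cong_def C h by (simp add: mult_mod_right[symmetric])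
    also have "\<dots> \<longleftrightarrow> s mod h = c" using c(1) by (metis zmod_int of_nat_eq_iff)
    finally show ?thesis .
  qed
  have "{s. s < r \<and> [2 * int s = B] (mod int r)} = {c, c + h}"
  proof (intro set_eqI iffI)
    fix s assume "s \<in> {s. s < r \<and> [2 * int s = B] (mod int r)}"
    then have "s < 2 * h" "s mod h = c" using iff h by auto
    then show "s \<in> {c, c + h}" 
      by (cases "s < h") (auto simp: le_mod_geq)
  next
    fix s assume "s \<in> {c, c + h}"
    then have "s < r" "s mod h = c" using c(2) h by auto
    then show "s \<in> {s. s < r \<and> [2 * int s = B] (mod int r)}" by (simp add: iff)
  qed
  then show ?thesis using True h0 by simp
next
  case False
  have "\<not> [2 * int s = B] (mod int r)" for s
    using False assms(1) cong_dvd_iff[of "2 * int s" B 2] cong_dvd_modulus[of "2 * int s" B "int r" 2]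
    by auto
  then show ?thesis using False by simp
qed

subsection \<open>Square roots on invariant sets\<close>

text \<open>Square roots living on \<open>X\<close> only: \<tau> and \<open>w\<close> are consulted
  on \<open>X\<close> alone, so the same pair serves every union of cycles of \<tau> that occurs in
  the recursion.\<close>

definition roots :: "nat \<Rightarrow> (nat \<Rightarrow> nat) \<Rightarrow> (nat \<Rightarrow> nat) \<Rightarrow> nat set \<Rightarrow> gelem set" where
  "roots r w \<tau> X = {(z, \<sigma>). \<sigma> permutes X \<and> (\<forall>i\<in>X. \<sigma> (\<sigma> i) = \<tau> i) \<and> z \<in> colourings r w \<sigma> X}"

lemma finite_colourings:
  assumes "finite A"
  shows "finite (colourings r w \<sigma> A)"
  by (rule finite_subset[OF _ finite_set_of_finite_funs[OF assms finite_lessThan[of r], of 0]])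
    (auto simp: colourings_def)

lemma finite_roots:
  assumes "finite X"
  shows "finite (roots r w \<tau> X)"
proof (rule finite_subset)
  show "roots r w \<tau> X \<subseteq> {z. \<forall>i. (i \<in> X \<longrightarrow> z i \<in> {..<r}) \<and> (i \<notin> X \<longrightarrow> z i = 0)} \<times> {\<sigma>. \<sigma> permutes X}"
    by (auto simp: roots_def colourings_def)
  show "finite ({z. \<forall>i. (i \<in> X \<longrightarrow> z i \<in> {..<r}) \<and> (i \<notin> X \<longrightarrow> z i = (0::nat))} \<times> {\<sigma>. \<sigma> permutes X})"
    using finite_set_of_finite_funs[OF assms finite_lessThan] finite_permutations[OF assms] by blast
qed

lemma roots_empty: "roots r w \<tau> {} = {(\<lambda>_. 0, id)}"
  by (auto simp: roots_def colourings_def)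

lemma sqrt_count_eq_roots:
  assumes "(w, \<tau>) \<in> Gr r n"
  shows "sqrt_count r n (w, \<tau>) = card (roots r w \<tau> {1..n})"
proof -
  have "p \<in> Gr r n \<and> Gmult r n p p = (w, \<tau>) \<longleftrightarrow> p \<in> roots r w \<tau> {1..n}" for p
  proof (cases p)
    case (Pair z \<sigma>)
    have *: "(\<forall>i. (if i \<in> {1..n} then (z i + z (inv \<sigma> i)) mod r else 0) = w i) \<longleftrightarrow>
        (\<forall>i\<in>{1..n}. (z (\<sigma> i) + z i) mod r = w (\<sigma> i))" if \<sigma>: "\<sigma> permutes {1..n}"
    proof
      assume L: "\<forall>i. (if i \<in> {1..n} then (z i + z (inv \<sigma> i)) mod r else 0) = w i"
      show "\<forall>i\<in>{1..n}. (z (\<sigma> i) + z i) mod r = w (\<sigma> i)"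
      proof
        fix i assume "i \<in> {1..n}"
        then have "\<sigma> i \<in> {1..n}" by (simp only: permutes_in_image[OF \<sigma>])
        then show "(z (\<sigma> i) + z i) mod r = w (\<sigma> i)"
          using L[rule_format, of "\<sigma> i"] permutes_inverses(2)[OF \<sigma>] by simp
      qed
    next
      assume R: "\<forall>i\<in>{1..n}. (z (\<sigma> i) + z i) mod r = w (\<sigma> i)"
      show "\<forall>i. (if i \<in> {1..n} then (z i + z (inv \<sigma> i)) mod r else 0) = w i"
      proof
        fix i
        show "(if i \<in> {1..n} then (z i + z (inv \<sigma> i)) mod r else 0) = w i"
        proof (cases "i \<in> {1..n}")
          case True
          then have "inv \<sigma> i \<in> {1..n}" by (simp only: permutes_in_image[OF permutes_inv[OF \<sigma>]])
          then show ?thesis using R[rule_format, of "inv \<sigma> i"] permutes_inverses(1)[OF \<sigma>] True by simp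
        qed (use assms in \<open>auto simp: Gr_def\<close>)
      qed
    qed
    have **: "\<sigma> \<circ> \<sigma> = \<tau> \<longleftrightarrow> (\<forall>i\<in>{1..n}. \<sigma> (\<sigma> i) = \<tau> i)" if \<sigma>: "\<sigma> permutes {1..n}"
    proof -
      have "\<tau> permutes {1..n}" using assms by (simp add: Gr_def)
      then have "\<sigma> (\<sigma> i) = \<tau> i" if "i \<notin> {1..n}" for i
        using permutes_not_in[OF \<sigma> that] permutes_not_in[OF _ that] by metis
      then show ?thesis by (metis comp_apply ext)
    qed
    have "Gmult r n p p = (w, \<tau>) \<longleftrightarrow>
        (\<forall>i. (if i \<in> {1..n} then (z i + z (inv \<sigma> i)) mod r else 0) = w i) \<and> \<sigma> \<circ> \<sigma> = \<tau>"
      by (simp add: Pair Gmult_def fun_eq_iff)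
    then show ?thesis
      by (cases "\<sigma> permutes {1..n}")
        (simp_all only: Pair Gr_def roots_def colourings_def mem_Collect_eq prod.case * ** simp_thms conj_ac)
  qed
  then show ?thesis by (simp add: sqrt_count_def)
qed

section \<open>Gluing and restricting roots along a disjoint union\<close>

lemma permutes_glue:
  assumes "\<sigma> permutes A" "\<sigma>' permutes B" "A \<inter> B = {}"
  shows "(\<lambda>i. if i \<in> A then \<sigma> i else \<sigma>' i) permutes (A \<union> B)"
proof (rule bij_imp_permutes)
  have "bij_betw (\<lambda>i. if i \<in> A then \<sigma> i else \<sigma>' i) A A"
    using permutes_imp_bij[OF assms(1)] by (rule bij_betw_cong[THEN iffD1, rotated]) simp
  moreover have "bij_betw (\<lambda>i. if i \<in> A then \<sigma> i else \<sigma>' i) B B"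
    using permutes_imp_bij[OF assms(2)]
    by (rule bij_betw_cong[THEN iffD1, rotated]) (use assms(3) in auto)
  ultimately show "bij_betw (\<lambda>i. if i \<in> A then \<sigma> i else \<sigma>' i) (A \<union> B) (A \<union> B)"
    using assms(3) by (rule bij_betw_combine)
qed (use permutes_not_in[OF assms(2)] in auto)

lemma permutes_restrict:
  assumes "\<sigma> permutes X" "\<sigma> ` A = A"
  shows "(\<lambda>i. if i \<in> A then \<sigma> i else i) permutes A"
proof (rule bij_imp_permutes)
  have "bij_betw \<sigma> A A"
    using assms(2) permutes_inj_on[OF assms(1)] by (simp add: bij_betw_def)
  then show "bij_betw (\<lambda>i. if i \<in> A then \<sigma> i else i) A A"
    by (rule bij_betw_cong[THEN iffD1, rotated]) simp
qed auto

text \<open>A root that preserves \<open>A\<close> also preserves the complement \<open>B\<close>,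
  and its two restrictions are independent of each other. The condition on the image of
  \<open>C\<close> is seen by the restriction to \<open>A\<close> alone. It is applied with
  \<open>A\<close> a fixed cycle or the union of two swapped cycles.\<close>

lemma card_roots_split:
  assumes disj: "A \<inter> B = {}" and CA: "C \<subseteq> A"
  shows "card {p \<in> roots r w \<tau> (A \<union> B). snd p ` C = D \<and> snd p ` A = A} =
    card {p \<in> roots r w \<tau> A. snd p ` C = D} * card (roots r w \<tau> B)"
proof -
  define glue :: "gelem \<times> gelem \<Rightarrow> gelem" where
    "glue = (\<lambda>((z, \<sigma>), (z', \<sigma>')). (\<lambda>i. if i \<in> A then z i else z' i, \<lambda>i. if i \<in> A then \<sigma> i else \<sigma>' i))"
  \<comment> \<open>Off \<open>Y\<close> the values are the defaults that \<open>roots\<close>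
    demands: colour 0 and a fixed point of the permutation.\<close>
  define restr :: "nat set \<Rightarrow> gelem \<Rightarrow> gelem" where
    "restr = (\<lambda>Y (z, \<sigma>). (\<lambda>i. if i \<in> Y then z i else 0, \<lambda>i. if i \<in> Y then \<sigma> i else i))"
  let ?L = "{p \<in> roots r w \<tau> A. snd p ` C = D} \<times> roots r w \<tau> B"
  let ?R = "{p \<in> roots r w \<tau> (A \<union> B). snd p ` C = D \<and> snd p ` A = A}"
  have restr_in: "restr Y (z, \<sigma>) \<in> roots r w \<tau> Y"
    if p: "(z, \<sigma>) \<in> roots r w \<tau> X" and Y: "Y \<subseteq> X" "\<sigma> ` Y = Y" for X Y z \<sigma>
  proof -
    have "\<sigma> i \<in> Y" if "i \<in> Y" for i using Y(2) that by blast
    then show ?thesis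
      using p Y(1) permutes_restrict[OF _ Y(2), of X]
      by (auto simp: restr_def roots_def colourings_def subset_iff)
  qed
  have "bij_betw glue ?L ?R"
  proof (rule bij_betw_byWitness[where f' = "\<lambda>p. (restr A p, restr B p)"])
    show "\<forall>a\<in>?L. (restr A (glue a), restr B (glue a)) = a"
      using disj by (auto simp: glue_def restr_def roots_def colourings_def permutes_def fun_eq_iff)
    show "\<forall>p\<in>?R. glue (restr A p, restr B p) = p"
      by (auto simp: glue_def restr_def roots_def colourings_def permutes_def fun_eq_iff)
    show "glue ` ?L \<subseteq> ?R"
    proof (rule image_subsetI)
      fix pq assume pq: "pq \<in> ?L"
      obtain z \<sigma> z' \<sigma>' where eq: "pq = ((z, \<sigma>), (z', \<sigma>'))" by (metis surj_pair)
      have p: "(z, \<sigma>) \<in> roots r w \<tau> A" and q: "(z', \<sigma>') \<in> roots r w \<tau> B" and D: "\<sigma> ` C = D"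
        using pq by (auto simp: eq)
      have \<sigma>: "\<sigma> permutes A" "\<sigma>' permutes B" using p q by (auto simp: roots_def)
      have mem: "\<sigma> i \<in> A" if "i \<in> A" for i using that permutes_in_image[OF \<sigma>(1)] by blast
      have mem': "\<sigma>' i \<in> B" "\<sigma>' i \<notin> A" "i \<notin> A" if "i \<in> B" for i
        using that permutes_in_image[OF \<sigma>(2)] disj by blast+
      have "glue ((z, \<sigma>), (z', \<sigma>')) \<in> roots r w \<tau> (A \<union> B)"
        using p q permutes_glue[OF \<sigma> disj] mem mem'
        by (auto simp: glue_def roots_def colourings_def)
      moreover have "snd (glue ((z, \<sigma>), (z', \<sigma>'))) ` C = \<sigma> ` C"
        using CA by (auto simp: glue_def intro!: image_cong)
      moreover have "snd (glue ((z, \<sigma>), (z', \<sigma>'))) ` A = \<sigma> ` A"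
        by (auto simp: glue_def intro!: image_cong)
      ultimately show "glue pq \<in> ?R"
        using permutes_image[OF \<sigma>(1)] D by (simp add: eq)
    qed
    show "(\<lambda>p. (restr A p, restr B p)) ` ?R \<subseteq> ?L"
    proof (rule image_subsetI)
      fix p assume p: "p \<in> ?R"
      obtain z \<sigma> where ps: "p = (z, \<sigma>)" by (cases p)
      have \<sigma>: "\<sigma> permutes (A \<union> B)" "\<sigma> ` A = A" "\<sigma> ` C = D" using p by (auto simp: ps roots_def)
      have "\<sigma> ` (A \<union> B - A) = A \<union> B - A"
        using image_set_diff[OF permutes_inj[OF \<sigma>(1)], of "A \<union> B" A] permutes_image[OF \<sigma>(1)] \<sigma>(2) by simp
      moreover have "A \<union> B - A = B" using disj by blast
      ultimately have "\<sigma> ` B = B" by simp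
      then have "restr A p \<in> roots r w \<tau> A" "restr B p \<in> roots r w \<tau> B"
        using restr_in[of z \<sigma> "A \<union> B"] p \<sigma>(2) by (auto simp: ps)
      moreover have "snd (restr A p) ` C = \<sigma> ` C"
        using CA by (auto simp: restr_def ps intro!: image_cong)
      ultimately show "(restr A p, restr B p) \<in> ?L" using \<sigma>(3) by simp
    qed
  qed
  then show ?thesis by (simp add: bij_betw_same_card[symmetric] card_cartesian_product)
qed

section \<open>Permutation parts of roots on one cycle and on a swapped pair\<close>

definition sqrt_perms :: "(nat \<Rightarrow> nat) \<Rightarrow> nat set \<Rightarrow> (nat \<Rightarrow> nat) set" where
  "sqrt_perms \<tau> X = {\<sigma>. \<sigma> permutes X \<and> (\<forall>i\<in>X. \<sigma> (\<sigma> i) = \<tau> i)}"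

lemma sqrt_perms_funpow:
  assumes "\<sigma> \<in> sqrt_perms \<tau> X" "i \<in> X"
  shows "(\<tau> ^^ k) i = (\<sigma> ^^ (2 * k)) i"
proof (induction k)
  case (Suc k)
  have "\<sigma> permutes X" using assms(1) by (simp add: sqrt_perms_def)
  then have "(\<sigma> ^^ (2 * k)) i \<in> X" using assms(2) by (rule permutes_in_funpow_image)
  then show ?case using assms(1) Suc by (simp add: sqrt_perms_def)
qed simp

text \<open>On \<open>X\<close> the powers of \<tau> are even powers of \<sigma>, and these commute
  with \<sigma>. Consequently \<sigma> sends cycles of \<tau> to cycles of \<tau>.\<close>

lemma sqrt_perms_commute:
  assumes "\<sigma> \<in> sqrt_perms \<tau> X" "i \<in> X"
  shows "\<sigma> ((\<tau> ^^ k) i) = (\<tau> ^^ k) (\<sigma> i)"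
proof -
  have "\<sigma> i \<in> X" using assms permutes_in_image by (force simp: sqrt_perms_def)
  then show ?thesis
    using funpow_swap1[of \<sigma> "2 * k" i] by (simp add: sqrt_perms_funpow[OF assms(1)] assms(2))
qed

lemma sqrt_perms_image_cycle:
  assumes "\<sigma> \<in> sqrt_perms \<tau> X" "i \<in> X"
  shows "\<sigma> ` cycle_of \<tau> i = cycle_of \<tau> (\<sigma> i)"
  unfolding cycle_of_def by (simp add: image_image sqrt_perms_commute[OF assms])

lemma roots_eq_Sigma: "roots r w \<tau> X = prod.swap ` (SIGMA \<sigma>:sqrt_perms \<tau> X. colourings r w \<sigma> X)"
  by (auto simp: roots_def sqrt_perms_def image_iff)

lemma funpow_image_cycle_of:
  assumes "\<tau> permutes S" "finite S"
  shows "(\<tau> ^^ m) ` cycle_of \<tau> a = cycle_of \<tau> a"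
proof (induction m)
  case (Suc m)
  have "(\<tau> ^^ Suc m) ` cycle_of \<tau> a = \<tau> ` (\<tau> ^^ m) ` cycle_of \<tau> a" by (simp add: image_image)
  then show ?case by (simp add: Suc permutes_image_cycle_of[OF assms])
qed simp

text \<open>An orbit of \<sigma> contains the corresponding orbit of \<tau>, so a square root is
  itself a single cycle on \<open>C\<close>. If |C| = 2h, then \<tau>^h = \<sigma>^(2h) fixes
  \<open>a\<close>, too early for a cycle of length 2h. If |C| = 2h + 1, then \<sigma> =
  \<sigma>^(2h+2) = \<tau>^(h+1), which leaves one candidate, and it works.\<close>

lemma sqrt_perms_cycle:
  assumes \<tau>: "\<tau> permutes S" "finite S" and C_def: "C = cycle_of \<tau> a"
  shows "sqrt_perms \<tau> C =
      (if even (card C) then {} else {\<lambda>i. if i \<in> C then (\<tau> ^^ Suc (card C div 2)) i else i})"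
    and "\<sigma> \<in> sqrt_perms \<tau> C \<Longrightarrow> cycle_of \<sigma> a = C"
proof -
  define \<rho> where "\<rho> = (\<lambda>i. if i \<in> C then (\<tau> ^^ Suc (card C div 2)) i else i)"
  have C: "cycle_of \<tau> i = C" if "i \<in> C" for i
    using cycle_of_eq[OF \<tau>] that by (simp add: C_def)
  have finC: "finite C" unfolding C_def by (rule finite_cycle_of[OF \<tau>])
  have cyc: "cycle_of \<sigma> i = C" if \<sigma>: "\<sigma> \<in> sqrt_perms \<tau> C" and i: "i \<in> C" for \<sigma> i
  proof
    show "cycle_of \<sigma> i \<subseteq> C"
      by (rule cycle_of_subset) (use \<sigma> i in \<open>auto simp: sqrt_perms_def\<close>)
    show "C \<subseteq> cycle_of \<sigma> i"
      unfolding C[OF i, symmetric] cycle_of_def sqrt_perms_funpow[OF \<sigma> i] by auto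
  qed
  have a: "a \<in> C" unfolding C_def by (rule self_in_cycle_of)
  show "\<sigma> \<in> sqrt_perms \<tau> C \<Longrightarrow> cycle_of \<sigma> a = C" using cyc[OF _ a] .
  have period: "(\<sigma> ^^ card C) i = i" if \<sigma>: "\<sigma> \<in> sqrt_perms \<tau> C" and i: "i \<in> C" for \<sigma> i
    using funpow_card[of \<sigma> C i] finC \<sigma> cyc[OF \<sigma> i] by (simp add: sqrt_perms_def)
  have "sqrt_perms \<tau> C = (if even (card C) then {} else {\<rho>})"
  proof (cases "even (card C)")
    case True
    have "False" if \<sigma>: "\<sigma> \<in> sqrt_perms \<tau> C" for \<sigma>
    proof -
      have "(\<tau> ^^ (card C div 2)) a = a"
        using period[OF \<sigma> a] True by (simp add: sqrt_perms_funpow[OF \<sigma> a])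
      then have "(card C div 2) mod card C = 0"
        using funpow_eq_iff_card[OF \<tau>, of "card C div 2" a 0] by (simp add: C_def)
      moreover have "card C > 0" unfolding C_def by (rule card_cycle_of_pos[OF \<tau>])
      ultimately show False using True by auto
    qed
    then show ?thesis using True by auto
  next
    case False
    then have twice: "2 * Suc (card C div 2) = Suc (card C)" by presburger
    have "\<sigma> = \<rho>" if \<sigma>: "\<sigma> \<in> sqrt_perms \<tau> C" for \<sigma>
    proof
      fix i
      show "\<sigma> i = \<rho> i"
      proof (cases "i \<in> C")
        case True
        have "(\<tau> ^^ Suc (card C div 2)) i = (\<sigma> ^^ Suc (card C)) i"
          unfolding sqrt_perms_funpow[OF \<sigma> True] twice ..
        then show ?thesis using True period[OF \<sigma> True] by (simp add: \<rho>_def)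
      next
        case False
        then show ?thesis using \<sigma> permutes_not_in[of \<sigma> C i] by (simp add: sqrt_perms_def \<rho>_def)
      qed
    qed
    moreover have "\<rho> \<in> sqrt_perms \<tau> C"
      unfolding sqrt_perms_def
    proof (intro CollectI conjI ballI)
      have im: "(\<tau> ^^ Suc (card C div 2)) ` C = C"
        unfolding C_def by (rule funpow_image_cycle_of[OF \<tau>])
      show "\<rho> permutes C"
        unfolding \<rho>_def by (rule permutes_restrict[OF permutes_funpow[OF \<tau>(1)] im])
      fix i assume i: "i \<in> C"
      then have "(\<tau> ^^ Suc (card C div 2)) i \<in> C" using im by blast
      then have "\<rho> (\<rho> i) = (\<tau> ^^ (Suc (card C div 2) + Suc (card C div 2))) i"
        using i unfolding funpow_add_apply by (simp add: \<rho>_def)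
      also have "\<dots> = (\<tau> ^^ Suc (card C)) i" using twice by (simp only: mult_2)
      also have "\<dots> = \<tau> i" using funpow_card[OF \<tau>, of i] C[OF i] by simp
      finally show "\<rho> (\<rho> i) = \<tau> i" .
    qed
    ultimately have "sqrt_perms \<tau> C = {\<rho>}" by blast
    then show ?thesis using False by simp
  qed
  then show "sqrt_perms \<tau> C =
      (if even (card C) then {} else {\<lambda>i. if i \<in> C then (\<tau> ^^ Suc (card C div 2)) i else i})"
    by (simp only: \<rho>_def)
qed

lemma card_roots_cycle:
  assumes \<tau>: "\<tau> permutes S" "finite S" and a: "a \<in> S"
    and C_def: "C = cycle_of \<tau> a" and w: "\<And>i. i \<in> S \<Longrightarrow> w i < r"
  shows "card (roots r w \<tau> C) =
    (if even (card C) then 0 else if odd r then 1 else if even (cycle_color r w C) then 2 else 0)"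
proof (cases "even (card C)")
  case True
  then show ?thesis
    using sqrt_perms_cycle(1)[OF \<tau> C_def] by (simp add: roots_eq_Sigma)
next
  case False
  then obtain \<rho> where \<rho>: "sqrt_perms \<tau> C = {\<rho>}"
    using sqrt_perms_cycle(1)[OF \<tau> C_def] by simp
  have cyc: "C = cycle_of \<rho> a"
    using sqrt_perms_cycle(2)[OF \<tau> C_def, of \<rho>] \<rho> by simp
  have perm: "\<rho> permutes C" using \<rho> by (auto simp: sqrt_perms_def)
  have fin: "finite C" unfolding C_def by (rule finite_cycle_of[OF \<tau>])
  have wC: "w i < r" if "i \<in> C" for i
    using w that cycle_of_subset[OF \<tau>(1) a] by (auto simp: C_def)
  let ?B = "alt_sum (\<lambda>k. w ((\<rho> ^^ Suc k) a)) (card C)"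
  have "roots r w \<tau> C = (\<lambda>z. (z, \<rho>)) ` colourings r w \<rho> C"
    unfolding roots_eq_Sigma \<rho> by auto
  then have "card (roots r w \<tau> C) = card (colourings r w \<rho> C)"
    by (simp add: card_image inj_on_def)
  also have "\<dots> = card {s. s < r \<and> [(-1) ^ card C * int s + ?B = int s] (mod int r)}"
    by (rule card_colourings_cycle[OF perm fin cyc wC])
  also have "{s. s < r \<and> [(-1) ^ card C * int s + ?B = int s] (mod int r)} =
      {s. s < r \<and> [2 * int s = ?B] (mod int r)}"
  proof -
    \<comment> \<open>The length is odd, so the sign is -1 and the closing condition -s + B = s
      turns into 2s = B.\<close>
    have "[(-1) ^ card C * int s + ?B = int s] (mod int r) \<longleftrightarrow> [2 * int s = ?B] (mod int r)" for s
      using False cong_sym_eq[of "2 * int s"] by (simp add: cong_iff_dvd_diff algebra_simps)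
    then show ?thesis by simp
  qed
  also have "card \<dots> = (if odd r then 1 else if even ?B then 2 else 0)"
  proof -
    have "r > 0" using wC[of a] self_in_cycle_of[of a \<tau>] by (auto simp: C_def)
    then show ?thesis using card_halves_odd[of r ?B] card_halves_even[of r ?B] by auto
  qed
  \<comment> \<open>The colour is this sum reduced modulo \<open>r\<close>, and the reduction keeps
    the parity when \<open>r\<close> is even, the only case in which the parity is
    consulted.\<close>
  also have "even ?B \<longleftrightarrow> even (\<Sum>u\<in>C. w u)"
    unfolding even_alt_sum_iff using sum_cycle_of_Suc[OF perm fin, of w a] by (simp flip: cyc)
  finally show ?thesis
    using False by (auto simp: cycle_color_def dvd_mod_iff)
qed

text \<open>The image d of \<open>a\<close> can be any point of \<open>C'\<close> and determines
  everything: commuting with \<tau> forces \<sigma> (\<tau>^k a) = \<tau>^k d, and \<sigma> \<sigma>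
  = \<tau> then forces the way back.\<close>

lemma card_sqrt_perms_swap:
  assumes \<tau>: "\<tau> permutes S" "finite S"
    and C_def: "C = cycle_of \<tau> a" and C'_def: "C' = cycle_of \<tau> c"
    and neq: "C \<noteq> C'" and same: "card C = card C'"
  shows "card {\<sigma> \<in> sqrt_perms \<tau> (C \<union> C'). \<sigma> ` C = C'} = card C"
proof -
  have disj: "C \<inter> C' = {}"
    using cycle_of_disjoint[OF \<tau>] neq unfolding C_def C'_def by blast
  have fin: "finite C" "finite C'" unfolding C_def C'_def by (rule finite_cycle_of[OF \<tau>])+
  have a: "a \<in> C" unfolding C_def by (rule self_in_cycle_of)
  have C': "cycle_of \<tau> i = C'" if "i \<in> C'" for i
    using cycle_of_eq[OF \<tau>] that by (simp add: C'_def)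
  have C_ex: "\<exists>k. i = (\<tau> ^^ k) a" if "i \<in> C" for i
    using that unfolding C_def by (auto simp: cycle_of_def)
  have C'_ex: "\<exists>k. i = (\<tau> ^^ k) d" if "i \<in> C'" "d \<in> C'" for i d
    using that(1) unfolding C'[OF that(2), symmetric] by (auto simp: cycle_of_def)
  let ?P = "{\<sigma> \<in> sqrt_perms \<tau> (C \<union> C'). \<sigma> ` C = C'}"
  have "bij_betw (\<lambda>\<sigma>. \<sigma> a) ?P C'"
  proof (rule bij_betw_imageI)
    show "inj_on (\<lambda>\<sigma>. \<sigma> a) ?P"
    proof (rule inj_onI, rule ext)
      fix \<sigma> \<sigma>' i assume s: "\<sigma> \<in> ?P" and s': "\<sigma>' \<in> ?P" and e: "\<sigma> a = \<sigma>' a"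
      have ss: "\<sigma> \<in> sqrt_perms \<tau> (C \<union> C')" "\<sigma>' \<in> sqrt_perms \<tau> (C \<union> C')" using s s' by auto
      have onC: "\<sigma> x = \<sigma>' x" if "x \<in> C" for x
        using C_ex[OF that] sqrt_perms_commute[OF ss(1), of a] sqrt_perms_commute[OF ss(2), of a] a e
        by auto
      have onC': "\<sigma> x = \<sigma>' x" if "x \<in> C'" for x
      proof -
        have "x \<in> \<sigma> ` C" using s that by simp
        then obtain y where y: "y \<in> C" "x = \<sigma> y" by blast
        have "\<sigma> (\<sigma> y) = \<tau> y" "\<sigma>' (\<sigma>' y) = \<tau> y" using ss y(1) by (auto simp: sqrt_perms_def)
        then show ?thesis using y(2) onC[OF y(1)] by simp
      qed
      show "\<sigma> i = \<sigma>' i"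
      proof (cases "i \<in> C \<union> C'")
        case False
        then show ?thesis
          using ss permutes_not_in[of \<sigma> "C \<union> C'" i] permutes_not_in[of \<sigma>' "C \<union> C'" i]
          by (simp add: sqrt_perms_def)
      qed (use onC onC' in auto)
    qed
    show "(\<lambda>\<sigma>. \<sigma> a) ` ?P = C'"
    proof
      show "(\<lambda>\<sigma>. \<sigma> a) ` ?P \<subseteq> C'" using a by auto
      show "C' \<subseteq> (\<lambda>\<sigma>. \<sigma> a) ` ?P"
      proof
        fix d assume d: "d \<in> C'"
        have "\<exists>\<phi>. \<forall>k. \<phi> ((\<tau> ^^ k) a) = (\<tau> ^^ k) d"
          by (rule exists_fun_on_cycle[OF \<tau>], unfold funpow_eq_iff_card[OF \<tau>])
            (simp add: C'[OF d] same[symmetric] flip: C_def)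
        then obtain \<phi> where \<phi>: "\<And>k. \<phi> ((\<tau> ^^ k) a) = (\<tau> ^^ k) d" by blast
        \<comment> \<open>The return map from \<open>C'\<close>: \<tau>^k d is the image of \<tau>^k
          a, so \<sigma> must take it to \<tau> (\<tau>^k a). The shift by one makes the square
          equal to \<tau> instead of the identity.\<close>
        have "\<exists>\<psi>. \<forall>k. \<psi> ((\<tau> ^^ k) d) = (\<tau> ^^ Suc k) a"
        proof (rule exists_fun_on_cycle[OF \<tau>], unfold funpow_eq_iff_card[OF \<tau>])
          fix k
          have "Suc (k + card (cycle_of \<tau> d)) = Suc k + card C" by (simp add: C'[OF d] same)
          then show "Suc (k + card (cycle_of \<tau> d)) mod card (cycle_of \<tau> a) =
              Suc k mod card (cycle_of \<tau> a)" unfolding C_def[symmetric] by (simp only: mod_add_self2)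
        qed
        then obtain \<psi> where \<psi>: "\<And>k. \<psi> ((\<tau> ^^ k) d) = (\<tau> ^^ Suc k) a" by blast
        define \<sigma> where "\<sigma> = (\<lambda>i. if i \<in> C then \<phi> i else if i \<in> C' then \<psi> i else i)"
        have inC: "(\<tau> ^^ k) a \<in> C" for k unfolding C_def by (rule funpow_in_cycle_of)
        have inC': "(\<tau> ^^ k) d \<in> C'" for k using funpow_in_cycle_of[of k \<tau> d] C'[OF d] by simp
        have \<sigma>a: "\<sigma> ((\<tau> ^^ k) a) = (\<tau> ^^ k) d" for k using inC[of k] by (simp add: \<sigma>_def \<phi>)
        have \<sigma>d: "\<sigma> ((\<tau> ^^ k) d) = (\<tau> ^^ Suc k) a" for k
          using inC'[of k] disj by (auto simp: \<sigma>_def \<psi>)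
        have sq: "\<sigma> (\<sigma> i) = \<tau> i" "\<sigma> i \<in> C \<union> C'" if i: "i \<in> C \<union> C'" for i
        proof -
          consider k where "i = (\<tau> ^^ k) a" | k where "i = (\<tau> ^^ k) d"
            using i C_ex C'_ex[OF _ d] by blast
          then have "\<sigma> (\<sigma> i) = \<tau> i \<and> \<sigma> i \<in> C \<union> C'"
          proof cases
            case (1 k)
            then show ?thesis using \<sigma>a[of k] \<sigma>d[of k] inC'[of k] by simp
          next
            case (2 k)
            then show ?thesis using \<sigma>a[of "Suc k"] \<sigma>d[of k] inC[of "Suc k"] by simp
          qed
          then show "\<sigma> (\<sigma> i) = \<tau> i" "\<sigma> i \<in> C \<union> C'" by auto
        qed
        have "\<sigma> permutes C \<union> C'"
        proof (rule bij_imp_permutes)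
          \<comment> \<open>The square of \<sigma> agrees with the injective \<tau> on this set;
            surjectivity then comes from finiteness.\<close>
          have inj: "inj_on \<sigma> (C \<union> C')"
            by (rule inj_onI) (metis sq(1) permutes_inj[OF \<tau>(1)] injD)
          have "\<sigma> ` (C \<union> C') = C \<union> C'"
            by (rule endo_inj_surj[OF _ _ inj]) (use fin sq(2) in auto)
          then show "bij_betw \<sigma> (C \<union> C') (C \<union> C')" using inj by (simp add: bij_betw_def)
        qed (simp add: \<sigma>_def)
        moreover have "\<sigma> ` C = C'"
        proof -
          have "\<sigma> ` C = range (\<lambda>k. \<sigma> ((\<tau> ^^ k) a))"
            unfolding C_def cycle_of_def by (simp add: image_image)
          also have "\<dots> = cycle_of \<tau> d" by (simp add: \<sigma>a cycle_of_def)
          finally show ?thesis by (simp add: C'[OF d])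
        qed
        ultimately have "\<sigma> \<in> ?P" using sq(1) by (simp add: sqrt_perms_def)
        moreover have "\<sigma> a = d" using \<sigma>a[of 0] by simp
        ultimately show "d \<in> (\<lambda>\<sigma>. \<sigma> a) ` ?P" by blast
      qed
    qed
  qed
  from bij_betw_same_card[OF this] show ?thesis by (simp add: same)
qed

text \<open>\<sigma> merges the two cycles into one of length 2|C|: its even iterates run through
  \<open>C\<close>, its odd ones through \<open>C'\<close>. The sign after a full turn is +1, so the
  starting value drops out of the closing condition. What remains is that the two colour sums agree
  modulo \<open>r\<close>; then all \<open>r\<close> starting values work.\<close>

lemma card_colourings_swap:
  assumes \<tau>: "\<tau> permutes S" "finite S"
    and C_def: "C = cycle_of \<tau> a" and C'_def: "C' = cycle_of \<tau> c"
    and w: "\<And>i. i \<in> C \<union> C' \<Longrightarrow> w i < r" and neq: "C \<noteq> C'" and \<sigma>: "\<sigma> \<in> sqrt_perms \<tau> (C \<union> C')" "\<sigma> ` C = C'"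
  shows "card (colourings r w \<sigma> (C \<union> C')) = (if cycle_color r w C = cycle_color r w C' then r else 0)"
proof -
  have a: "a \<in> C" unfolding C_def by (rule self_in_cycle_of)
  then have aU: "a \<in> C \<union> C'" by simp
  have disj: "C \<inter> C' = {}"
    using cycle_of_disjoint[OF \<tau>] neq unfolding C_def C'_def by blast
  have perm: "\<sigma> permutes C \<union> C'" using \<sigma>(1) by (simp add: sqrt_perms_def)
  have fin: "finite C" "finite C'" unfolding C_def C'_def by (rule finite_cycle_of[OF \<tau>])+
  then have finU: "finite (C \<union> C')" by simp
  have same: "card C' = card C"
    using card_image[OF permutes_inj_on[OF perm], of C] \<sigma>(2) by simp
  have cardU: "card (C \<union> C') = 2 * card C"
    using card_Un_disjoint[OF fin disj] same by simp
  have C': "C' = cycle_of \<tau> (\<sigma> a)"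
    using sqrt_perms_image_cycle[OF \<sigma>(1) aU] \<sigma>(2) by (simp add: C_def)
  have even_pow: "(\<sigma> ^^ (2 * k)) a = (\<tau> ^^ k) a" for k
    using sqrt_perms_funpow[OF \<sigma>(1) aU] by simp
  have odd_pow: "(\<sigma> ^^ Suc (2 * k)) a = (\<tau> ^^ k) (\<sigma> a)" for k
    using sqrt_perms_commute[OF \<sigma>(1) aU, of k] even_pow[of k] by simp
  have cyc: "C \<union> C' = cycle_of \<sigma> a"
  proof
    show "cycle_of \<sigma> a \<subseteq> C \<union> C'" by (rule cycle_of_subset[OF perm aU])
    have "C \<subseteq> cycle_of \<sigma> a"
      unfolding C_def cycle_of_def[of \<tau>] even_pow[symmetric] using funpow_in_cycle_of by blast
    moreover have "C' \<subseteq> cycle_of \<sigma> a"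
      unfolding C' cycle_of_def[of \<tau>] odd_pow[symmetric] using funpow_in_cycle_of by blast
    ultimately show "C \<union> C' \<subseteq> cycle_of \<sigma> a" by blast
  qed
  let ?b = "\<lambda>k. w ((\<sigma> ^^ Suc k) a)"
  \<comment> \<open>\<open>?b\<close> is shifted by one: an odd index means an even iterate of
    \<sigma>, hence a point of \<open>C\<close>, and an even index means a point of
    \<open>C'\<close>.\<close>
  have "alt_sum ?b (card (C \<union> C')) = int (\<Sum>u\<in>C. w u) - int (\<Sum>u\<in>C'. w u)"
  proof -
    have "(\<Sum>i<card C. ?b (2 * i + 1)) = (\<Sum>u\<in>C. w u)"
    proof -
      have "(\<sigma> ^^ Suc (2 * i + 1)) a = (\<tau> ^^ Suc i) a" for i
        using even_pow[of "Suc i"] by simp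
      then show ?thesis using sum_cycle_of_Suc[OF \<tau>, of w a] unfolding C_def by (simp only:)
    qed
    moreover have "(\<Sum>i<card C. ?b (2 * i)) = (\<Sum>u\<in>C'. w u)"
      unfolding odd_pow same[symmetric] unfolding C' sum_cycle_of[OF \<tau>] ..
    ultimately show ?thesis unfolding cardU alt_sum_double by (metis of_nat_sum)
  qed
  then have "[(-1) ^ card (C \<union> C') * int s + alt_sum ?b (card (C \<union> C')) = int s] (mod int r) \<longleftrightarrow>
      cycle_color r w C = cycle_color r w C'" for s
    unfolding cycle_color_def
    by (simp add: cardU cong_iff_dvd_diff flip: mod_eq_dvd_iff of_nat_mod of_nat_sum)
  then have "card (colourings r w \<sigma> (C \<union> C')) = card {s. s < r \<and> cycle_color r w C = cycle_color r w C'}"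
    using card_colourings_cycle[OF perm finU cyc w] by simp
  then show ?thesis by simp
qed

lemma card_roots_swap:
  assumes \<tau>: "\<tau> permutes S" "finite S"
    and C_def: "C = cycle_of \<tau> a" and C'_def: "C' = cycle_of \<tau> c"
    and w: "\<And>i. i \<in> C \<union> C' \<Longrightarrow> w i < r" and neq: "C \<noteq> C'"
  shows "card {p \<in> roots r w \<tau> (C \<union> C'). snd p ` C = C'} =
    (if card C = card C' \<and> cycle_color r w C = cycle_color r w C' then card C * r else 0)"
proof -
  let ?P = "{\<sigma> \<in> sqrt_perms \<tau> (C \<union> C'). \<sigma> ` C = C'}"
  have fin: "finite (C \<union> C')" unfolding C_def C'_def using finite_cycle_of[OF \<tau>] by blast
  have "{p \<in> roots r w \<tau> (C \<union> C'). snd p ` C = C'} = prod.swap ` (SIGMA \<sigma>:?P. colourings r w \<sigma> (C \<union> C'))"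
    unfolding roots_eq_Sigma by auto
  then have "card {p \<in> roots r w \<tau> (C \<union> C'). snd p ` C = C'} = card (SIGMA \<sigma>:?P. colourings r w \<sigma> (C \<union> C'))"
    by (simp add: card_image)
  also have "\<dots> = (\<Sum>\<sigma>\<in>?P. card (colourings r w \<sigma> (C \<union> C')))"
  proof (rule card_SigmaI)
    show "finite ?P"
      by (rule finite_subset[OF _ finite_permutations[OF fin]]) (auto simp: sqrt_perms_def)
  qed (simp add: finite_colourings[OF fin])
  also have "\<dots> = (\<Sum>\<sigma>\<in>?P. if cycle_color r w C = cycle_color r w C' then r else 0)"
  proof (rule sum.cong[OF refl])
    fix \<sigma> assume "\<sigma> \<in> ?P"
    then have "\<sigma> \<in> sqrt_perms \<tau> (C \<union> C')" "\<sigma> ` C = C'" by simp_all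
    then show "card (colourings r w \<sigma> (C \<union> C')) = (if cycle_color r w C = cycle_color r w C' then r else 0)"
      by (intro card_colourings_swap[OF \<tau> C_def C'_def w neq])
  qed
  also have "\<dots> = card ?P * (if cycle_color r w C = cycle_color r w C' then r else 0)" by simp
  also have "card ?P = (if card C = card C' then card C else 0)"
  proof (cases "card C = card C'")
    case True
    then show ?thesis
      using card_sqrt_perms_swap[OF \<tau> C_def C'_def neq] by simp
  next
    case False
    have "card C' = card C" if "\<sigma> \<in> ?P" for \<sigma>
    proof -
      have "\<sigma> permutes C \<union> C'" using that by (simp add: sqrt_perms_def)
      then show ?thesis using that card_image[OF permutes_inj_on, of \<sigma> _ C] by auto
    qed
    then have "?P = {}" using False by auto
    then show ?thesis using False by (metis card.empty)
  qed
  finally show ?thesis by simp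
qed

subsection \<open>The recursion over cycles\<close>

text \<open>Roots are sorted by the image D of \<open>C\<close>. If D = C, the cycle splits off
  alone. Otherwise \<sigma> maps D back to \<open>C\<close>, because \<sigma> \<sigma> = \<tau>
  preserves \<open>C\<close>; so the union of \<open>C\<close> and D is preserved and splits off as
  a pair.\<close>

lemma card_roots_insert_cycle:
  assumes \<tau>: "\<tau> permutes S" "finite S" and w: "\<And>i. i \<in> S \<Longrightarrow> w i < r"
    and sub: "insert C \<C> \<subseteq> cycle_of \<tau> ` S" and C: "C \<notin> \<C>"
  shows "card (roots r w \<tau> (\<Union>(insert C \<C>))) =
    card (roots r w \<tau> C) * card (roots r w \<tau> (\<Union>\<C>)) +
    (\<Sum>D\<in>\<C>. card {p \<in> roots r w \<tau> (C \<union> D). snd p ` C = D} * card (roots r w \<tau> (\<Union>(\<C> - {D}))))"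
proof -
  let ?X = "\<Union>(insert C \<C>)"
  let ?R = "\<lambda>D. {p \<in> roots r w \<tau> ?X. snd p ` C = D}"
  have fin\<C>: "finite \<C>" using finite_subset[OF sub] \<tau>(2) by auto
  have cyc: "\<exists>b. D = cycle_of \<tau> b \<and> b \<in> D \<and> D \<subseteq> S" if "D \<in> insert C \<C>" for D
  proof -
    obtain b where "b \<in> S" "D = cycle_of \<tau> b" using \<open>D \<in> insert C \<C>\<close> sub by blast
    then show ?thesis using cycle_of_subset[OF \<tau>(1), of b] self_in_cycle_of[of b \<tau>] by auto
  qed
  have finX: "finite ?X"
    by (rule finite_subset[OF _ \<tau>(2)]) (use cyc in blast)
  have disj: "D \<inter> E = {}" if "D \<in> insert C \<C>" "E \<in> insert C \<C>" "D \<noteq> E" for D E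
    using cyc[OF that(1)] cyc[OF that(2)] that(3) cycle_of_disjoint[OF \<tau>] by metis
  obtain a where a: "C = cycle_of \<tau> a" "a \<in> C" using cyc by blast
  have image_C: "\<sigma> ` C \<in> insert C \<C>" if "(z, \<sigma>) \<in> roots r w \<tau> ?X" for z \<sigma>
  proof -
    have \<sigma>: "\<sigma> \<in> sqrt_perms \<tau> ?X" using that by (simp add: roots_def sqrt_perms_def)
    have aX: "a \<in> ?X" using a by blast
    have "\<sigma> a \<in> ?X" using aX \<sigma> permutes_in_image[of \<sigma> ?X a] by (simp add: sqrt_perms_def)
    then obtain D where D: "D \<in> insert C \<C>" "\<sigma> a \<in> D" by blast
    obtain b where "D = cycle_of \<tau> b" using cyc[OF D(1)] by blast
    then have "cycle_of \<tau> (\<sigma> a) = D" using cycle_of_eq[OF \<tau>] D(2) by simp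
    then show ?thesis using sqrt_perms_image_cycle[OF \<sigma> aX] a(1) D(1) by simp
  qed
  then have "\<forall>p\<in>roots r w \<tau> ?X. snd p ` C \<in> insert C \<C>" by (metis prod.collapse)
  then have "roots r w \<tau> ?X = (\<Union>D\<in>insert C \<C>. ?R D)" by blast
  then have "card (roots r w \<tau> ?X) = card (\<Union>D\<in>insert C \<C>. ?R D)" by (rule arg_cong)
  also have "\<dots> = (\<Sum>D\<in>insert C \<C>. card (?R D))"
  proof (rule card_UN_disjoint)
    show "\<forall>D\<in>insert C \<C>. finite (?R D)" using finite_roots[OF finX] by simp
  qed (use fin\<C> in auto)
  also have "\<dots> = card (?R C) + (\<Sum>D\<in>\<C>. card (?R D))"
    using fin\<C> C by simp
  also have "card (?R C) = card (roots r w \<tau> C) * card (roots r w \<tau> (\<Union>\<C>))"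
  proof -
    have X: "?X = C \<union> \<Union>\<C>" by blast
    have fixC: "snd p ` C = C" if "p \<in> roots r w \<tau> C" for p
      using that permutes_image[of "snd p" C] by (simp add: roots_def case_prod_unfold)
    have "C \<inter> \<Union>\<C> = {}" using disj[of C] C by blast
    from card_roots_split[OF this order_refl, of r w \<tau> C]
    have "card (?R C) = card {p \<in> roots r w \<tau> C. snd p ` C = C} * card (roots r w \<tau> (\<Union>\<C>))"
      unfolding X by simp
    also have "{p \<in> roots r w \<tau> C. snd p ` C = C} = roots r w \<tau> C" using fixC by blast
    finally show ?thesis .
  qed
  also have "(\<Sum>D\<in>\<C>. card (?R D)) =
    (\<Sum>D\<in>\<C>. card {p \<in> roots r w \<tau> (C \<union> D). snd p ` C = D} * card (roots r w \<tau> (\<Union>(\<C> - {D}))))"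
  proof (rule sum.cong[OF refl])
    fix D assume D: "D \<in> \<C>"
    have X: "?X = (C \<union> D) \<union> \<Union>(\<C> - {D})" using D by blast
    have "C \<inter> E = {} \<and> D \<inter> E = {}" if "E \<in> \<C> - {D}" for E
      using disj[of C E] disj[of D E] that C D by auto
    then have dj: "(C \<union> D) \<inter> \<Union>(\<C> - {D}) = {}" by blast
    have "snd p ` (C \<union> D) = C \<union> D" if p: "p \<in> roots r w \<tau> ?X" and im: "snd p ` C = D" for p
    proof -
      have "snd p ` D = (\<lambda>i. snd p (snd p i)) ` C" by (simp add: im[symmetric] image_image)
      also have "\<dots> = \<tau> ` C" by (rule image_cong) (use p in \<open>auto simp: roots_def\<close>)
      also have "\<dots> = C" unfolding a(1) by (rule permutes_image_cycle_of[OF \<tau>])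
      finally show ?thesis using im by (simp add: image_Un Un_commute)
    qed
    then have "?R D = {p \<in> roots r w \<tau> ?X. snd p ` C = D \<and> snd p ` (C \<union> D) = C \<union> D}" by blast
    then show "card (?R D) = card {p \<in> roots r w \<tau> (C \<union> D). snd p ` C = D} * card (roots r w \<tau> (\<Union>(\<C> - {D})))"
      using card_roots_split[OF dj, of C r w \<tau> D] unfolding X by simp
  qed
  finally show ?thesis .
qed

text \<open>Only objects of equal type interact, so a single recursion on sets decouples into one
  numerical recursion per type. An object added to \<open>m\<close> others of its type either stands
  alone or takes one of \<open>m\<close> partners, whose removal leaves \<open>m - 1\<close>. Since
  the recursion also refers to sets with two objects fewer, the induction is on cardinality.\<close>

lemma prod_of_type_recursion:
  fixes F :: "'c set \<Rightarrow> real" and ty :: "'c \<Rightarrow> 't" and W :: "'t \<Rightarrow> nat \<Rightarrow> real"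
  assumes "finite V" and "\<And>c. c \<in> U \<Longrightarrow> ty c \<in> V" and "F {} = 1"
    and F: "\<And>c \<C>. finite \<C> \<Longrightarrow> c \<notin> \<C> \<Longrightarrow> insert c \<C> \<subseteq> U \<Longrightarrow>
      F (insert c \<C>) = \<alpha> (ty c) * F \<C> + (\<Sum>d\<in>\<C>. (if ty d = ty c then \<beta> (ty c) else 0) * F (\<C> - {d}))"
    and W0: "\<And>v. v \<in> V \<Longrightarrow> W v 0 = 1"
    and W: "\<And>v m. v \<in> V \<Longrightarrow> W v (Suc m) = \<alpha> v * W v m + real m * \<beta> v * W v (m - 1)"
    and "finite \<C>" "\<C> \<subseteq> U"
  shows "F \<C> = (\<Prod>v\<in>V. W v (card {c\<in>\<C>. ty c = v}))"
  using assms(7,8)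
proof (induction "card \<C>" arbitrary: \<C> rule: less_induct)
  case less
  show ?case
  proof (cases "\<C> = {}")
    case True
    then show ?thesis using W0 assms(3) by simp
  next
    case False
    then obtain c where c: "c \<in> \<C>" by blast
    define \<D> where "\<D> = \<C> - {c}"
    have \<C>: "\<C> = insert c \<D>" "c \<notin> \<D>" "finite \<D>" "\<D> \<subseteq> U" using c less.prems by (auto simp: \<D>_def)
    define v where "v = ty c"
    have v: "v \<in> V" using c less.prems(2) assms(2) by (auto simp: v_def)
    define M where "M = (\<lambda>\<B> u. card {c\<in>\<B>. ty c = u})"
    \<comment> \<open>Contribution of the types other than that of \<open>c\<close>; it is the same
      for every set that occurs in the recursion step.\<close>
    define P where "P = (\<Prod>u\<in>V-{v}. W u (M \<D> u))"
    have split: "(\<Prod>u\<in>V. W u (M \<B> u)) = W v (M \<B> v) * P" if "\<And>u. u \<noteq> v \<Longrightarrow> M \<B> u = M \<D> u" for \<B>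
      unfolding P_def using prod.remove[OF assms(1) v, of "\<lambda>u. W u (M \<B> u)"] that by simp
    have M\<C>: "M \<C> u = (if u = v then Suc (M \<D> v) else M \<D> u)" for u
    proof -
      have "{x \<in> \<C>. ty x = u} = (if u = v then insert c {x \<in> \<D>. ty x = v} else {x \<in> \<D>. ty x = u})"
        by (auto simp: \<C>(1) v_def)
      then show ?thesis using \<C>(2,3) by (simp add: M_def)
    qed
    have less1: "card \<D> < card \<C>" unfolding \<D>_def by (rule card_Diff1_less[OF less.prems(1) c])
    have F\<D>: "F \<D> = W v (M \<D> v) * P"
      using less.hyps[OF less1 \<C>(3,4)] split[of \<D>] by (simp add: M_def)
    have F\<D>d: "F (\<D> - {d}) = W v (M \<D> v - 1) * P" if d: "d \<in> \<D>" "ty d = v" for d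
    proof -
      have Md: "M (\<D> - {d}) u = (if u = v then M \<D> v - 1 else M \<D> u)" for u
      proof -
        have "{x \<in> \<D> - {d}. ty x = u} = (if u = v then {x \<in> \<D>. ty x = v} - {d} else {x \<in> \<D>. ty x = u})"
          using d by auto
        then show ?thesis using d \<C>(3) by (simp add: M_def)
      qed
      have "card (\<D> - {d}) < card \<C>"
        using less1 card_Diff1_le[of \<D> d] by linarith
      then have "F (\<D> - {d}) = (\<Prod>u\<in>V. W u (M (\<D> - {d}) u))"
        using less.hyps[of "\<D> - {d}"] \<C>(3,4) by (auto simp: M_def)
      then show ?thesis using split[of "\<D> - {d}"] Md by simp
    qed
    have "(\<Sum>d\<in>\<D>. (if ty d = v then \<beta> v else 0) * F (\<D> - {d})) =
        (\<Sum>d\<in>\<D>. if ty d = v then \<beta> v * (W v (M \<D> v - 1) * P) else 0)"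
      by (rule sum.cong[OF refl]) (simp add: F\<D>d)
    also have "\<dots> = real (M \<D> v) * \<beta> v * W v (M \<D> v - 1) * P"
      using \<C>(3) by (simp add: sum.If_cases M_def Int_def)
    finally have "F \<C> = (\<alpha> v * W v (M \<D> v) + real (M \<D> v) * \<beta> v * W v (M \<D> v - 1)) * P"
      using F[OF \<C>(3,2)] less.prems(2) F\<D> unfolding \<C>(1) v_def[symmetric] by (simp add: algebra_simps)
    also have "\<dots> = W v (M \<C> v) * P" using W[OF v] M\<C> by simp
    also have "\<dots> = (\<Prod>u\<in>V. W u (M \<C> u))" using split[of \<C>] M\<C> by simp
    finally show ?thesis by (simp add: M_def)
  qed
qed

text \<open>The coefficient of the monomial \<open>x_{t,j}^m\<close> in the factor that involves \<open>x_{t,j}\<close>.\<close>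

definition weight :: "nat \<Rightarrow> nat \<times> nat \<Rightarrow> nat \<Rightarrow> real" where
  "weight r v m = (case v of (t, j) \<Rightarrow>
     if even j \<or> even r \<and> odd t then if even m then real (dfact (m div 2)) * real (j * r) ^ (m div 2) else 0
     else if odd r then oc (real (r * j)) m
     else oc (real (r * j) / 4) m * 2 ^ m)"

section \<open>The recursion satisfied by the coefficients of D and R\<close>

lemma dfact_Suc: "dfact (Suc k) = (2 * k + 1) * dfact k"
  by (simp add: dfact_def)

text \<open>The binomials vanish beyond m div 2, so sums for different \<open>m\<close> can be
  brought to a common range before they are compared.\<close>

lemma oc_extend:
  assumes "m div 2 \<le> N"
  shows "oc c m = (\<Sum>k\<le>N. real (m choose (2 * k)) * real (dfact k) * c ^ k)"
  unfolding oc_def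
proof (rule sum.mono_neutral_left)
  show "\<forall>k\<in>{..N} - {..m div 2}. real (m choose (2 * k)) * real (dfact k) * c ^ k = 0"
  proof
    fix k assume "k \<in> {..N} - {..m div 2}"
    then have "m < 2 * k" by auto
    then show "real (m choose (2 * k)) * real (dfact k) * c ^ k = 0" by simp
  qed
qed (use assms in auto)

text \<open>\<open>oc c n\<close> counts the involutions of n points with weight \<open>c\<close>
  per 2-cycle: the last of m + 2 points is fixed or paired with one of the m + 1 others. The
  calculation uses Pascal's rule together with (2k+1) (m+1 choose 2k+1) = (m+1) (m choose
  2k).\<close>

lemma oc_Suc_Suc: "oc c (Suc (Suc m)) = oc c (Suc m) + real (Suc m) * c * oc c m"
proof -
  let ?t = "\<lambda>m k. real (m choose (2 * k)) * real (dfact k) * c ^ k"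
  have step: "?t (Suc (Suc m)) (Suc k) = ?t (Suc m) (Suc k) + real (Suc m) * c * ?t m k" for k
  proof -
    have "Suc (2 * k) * (Suc m choose Suc (2 * k)) = Suc m * (m choose (2 * k))"
      by (rule Suc_times_binomial)
    then have e: "real (2 * k + 1) * real (Suc m choose Suc (2 * k)) = real (Suc m) * real (m choose (2 * k))"
      by (metis Suc_eq_plus1 of_nat_mult)
    have "real (Suc (Suc m) choose (2 * Suc k)) = real (Suc m choose (2 * Suc k)) + real (Suc m choose Suc (2 * k))"
      by simp
    moreover have "real (Suc m choose Suc (2 * k)) * real (dfact (Suc k)) * c ^ Suc k =
        real (2 * k + 1) * real (Suc m choose Suc (2 * k)) * (c * real (dfact k) * c ^ k)"
      unfolding dfact_Suc of_nat_mult by (simp only: power_Suc mult_ac)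
    ultimately show ?thesis unfolding e by (simp only: distrib_right) (simp only: mult_ac)
  qed
  have "oc c (Suc (Suc m)) = (\<Sum>k\<le>Suc m. ?t (Suc (Suc m)) k)"
    by (rule oc_extend) simp
  also have "\<dots> = ?t (Suc (Suc m)) 0 + (\<Sum>k\<le>m. ?t (Suc (Suc m)) (Suc k))"
    by (rule sum.atMost_Suc_shift)
  also have "\<dots> = (?t (Suc m) 0 + (\<Sum>k\<le>m. ?t (Suc m) (Suc k))) + real (Suc m) * c * (\<Sum>k\<le>m. ?t m k)"
    unfolding step sum.distrib sum_distrib_left by simp
  also have "?t (Suc m) 0 + (\<Sum>k\<le>m. ?t (Suc m) (Suc k)) = (\<Sum>k\<le>Suc m. ?t (Suc m) k)"
    by (rule sum.atMost_Suc_shift[symmetric])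
  also have "\<dots> = oc c (Suc m)" by (rule oc_extend[symmetric]) simp
  also have "(\<Sum>k\<le>m. ?t m k) = oc c m" by (rule oc_extend[symmetric]) simp
  finally show ?thesis .
qed

lemma oc_0 [simp]: "oc c 0 = 1" and oc_1 [simp]: "oc c (Suc 0) = 1"
  by (simp_all add: oc_def dfact_def)

lemma weight_0: "weight r v 0 = 1"
  by (cases v) (simp add: weight_def dfact_def)

text \<open>The case distinction is the number of roots on one cycle of type (t, j), and j r the
  number of ways to swap two of them. In the last case the factor 2^m absorbs the quarter: 2^(k+2)
  rj/4 = 2^k rj. At m = 0 the truncated \<open>m - 1\<close> is multiplied by 0.\<close>

lemma weight_Suc:
  "weight r (t, j) (Suc m) =
    (if even j then 0 else if odd r then 1 else if even t then 2 else 0) * weight r (t, j) m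
    + real m * real (j * r) * weight r (t, j) (m - 1)"
proof (cases m)
  case 0
  then show ?thesis by (simp add: weight_def)
next
  case (Suc k)
  show ?thesis
  proof (cases "even j \<or> even r \<and> odd t")
    case True
    then show ?thesis
      by (auto simp: Suc weight_def dfact_Suc algebra_simps elim!: evenE)
  next
    case False
    then show ?thesis by (auto simp: Suc weight_def oc_Suc_Suc algebra_simps)
  qed
qed

section \<open>Cycle types and the product formula for the number of roots\<close>

definition cycle_type :: "nat \<Rightarrow> (nat \<Rightarrow> nat) \<Rightarrow> nat set \<Rightarrow> nat \<times> nat" where
  "cycle_type r w c = (cycle_color r w c, card c)"

lemma cyc_mult_eq: "cyc_mult r n (w, \<tau>) t j = card {c \<in> cycles \<tau> n. cycle_type r w c = (t, j)}"
  unfolding cyc_mult_def cycle_type_def by (simp add: conj_commute)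

lemma cycle_type_bounds:
  assumes "\<tau> permutes {1..n}" "r \<ge> 1" "c \<in> cycles \<tau> n"
  shows "cycle_type r w c \<in> {..<r} \<times> {1..n}"
proof -
  obtain a where a: "a \<in> {1..n}" "c = cycle_of \<tau> a" using assms(3) by (auto simp: cycles_def)
  have "card c \<le> n" using card_mono[OF _ cycle_of_subset[OF assms(1) a(1)]] a(2) by simp
  moreover have "card c > 0" using card_cycle_of_pos[OF assms(1)] a(2) by simp
  ultimately show ?thesis using assms(2) by (auto simp: cycle_type_def cycle_color_def)
qed

lemma cyc_mult_eq_0:
  assumes "(w, \<tau>) \<in> Gr r n" "r \<ge> 1" "(t, j) \<notin> {..<r} \<times> {1..n}"
  shows "cyc_mult r n (w, \<tau>) t j = 0"
proof -
  have "\<tau> permutes {1..n}" using assms(1) by (simp add: Gr_def)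
  then have "{c \<in> cycles \<tau> n. cycle_type r w c = (t, j)} = {}"
    using cycle_type_bounds[OF _ assms(2), of \<tau> n _ w] assms(3) by (metis (mono_tags, lifting) Collect_empty_eq)
  then show ?thesis unfolding cyc_mult_eq by (metis card.empty)
qed

lemma Union_cycles:
  assumes "\<tau> permutes {1..n}"
  shows "\<Union>(cycles \<tau> n) = {1..n}"
  using cycle_of_subset[OF assms] self_in_cycle_of by (fastforce simp: cycles_def)

lemma finite_cycles: "finite (cycles \<tau> n)"
  by (simp add: cycles_def)

text \<open>\<open>V\<close> may be larger than the set of types that can occur, since an absent
  type has weight 1. This freedom fits the formula to truncated products of any sufficient
  length.\<close>

lemma sqrt_count_eq_prod_weight:
  assumes g: "(w, \<tau>) \<in> Gr r n" and r: "r \<ge> 1" and V: "finite V" "{..<r} \<times> {1..n} \<subseteq> V"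
  shows "real (sqrt_count r n (w, \<tau>)) = (\<Prod>(t, j)\<in>V. weight r (t, j) (cyc_mult r n (w, \<tau>) t j))"
proof -
  have \<tau>: "\<tau> permutes {1..n}" and w: "\<And>i. i \<in> {1..n} \<Longrightarrow> w i < r" using g by (auto simp: Gr_def)
  \<comment> \<open>\<alpha> is the number of roots on a single cycle of type (t, j), \<beta> the
    number of roots that swap two such cycles.\<close>
  define \<alpha> :: "nat \<times> nat \<Rightarrow> real" where
    "\<alpha> = (\<lambda>(t, j). if even j then 0 else if odd r then 1 else if even t then 2 else 0)"
  define \<beta> :: "nat \<times> nat \<Rightarrow> real" where "\<beta> = (\<lambda>(t, j). real (j * r))"
  define F where "F = (\<lambda>\<C>. real (card (roots r w \<tau> (\<Union>\<C>))))"
  have "F (cycles \<tau> n) = (\<Prod>v\<in>V. weight r v (card {c \<in> cycles \<tau> n. cycle_type r w c = v}))"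
  proof (rule prod_of_type_recursion[where U = "cycles \<tau> n" and \<alpha> = \<alpha> and \<beta> = \<beta>])
    show "cycle_type r w c \<in> V" if "c \<in> cycles \<tau> n" for c
      using cycle_type_bounds[OF \<tau> r that] V(2) by blast
    show "F {} = 1" by (simp add: F_def roots_empty)
    show "weight r v (Suc m) = \<alpha> v * weight r v m + real m * \<beta> v * weight r v (m - 1)" for v m
      by (cases v) (simp only: weight_Suc \<alpha>_def \<beta>_def prod.case)
    fix C \<C> assume \<C>: "finite \<C>" "C \<notin> \<C>" "insert C \<C> \<subseteq> cycles \<tau> n"
    then have sub: "insert C \<C> \<subseteq> cycle_of \<tau> ` {1..n}" by (simp add: cycles_def)
    have C: "real (card (roots r w \<tau> C)) = \<alpha> (cycle_type r w C)"
    proof -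
      obtain a where a: "a \<in> {1..n}" "C = cycle_of \<tau> a" using sub by blast
      show ?thesis using card_roots_cycle[OF \<tau> _ a w] by (simp add: \<alpha>_def cycle_type_def)
    qed
    have D: "real (card {p \<in> roots r w \<tau> (C \<union> D). snd p ` C = D}) =
        (if cycle_type r w D = cycle_type r w C then \<beta> (cycle_type r w C) else 0)" if D: "D \<in> \<C>" for D
    proof -
      obtain a where a: "a \<in> {1..n}" "C = cycle_of \<tau> a" using sub by blast
      obtain b where b: "b \<in> {1..n}" "D = cycle_of \<tau> b" using sub D by blast
      have wCD: "w i < r" if "i \<in> C \<union> D" for i
        using that cycle_of_subset[OF \<tau> a(1)] cycle_of_subset[OF \<tau> b(1)] w a(2) b(2) by blast
      have "C \<noteq> D" using \<C>(2) D by blast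
      from card_roots_swap[OF \<tau> _ a(2) b(2) wCD this]
      show ?thesis by (auto simp: \<beta>_def cycle_type_def)
    qed
    have rec: "F (insert C \<C>) = real (card (roots r w \<tau> C)) * F \<C> +
        (\<Sum>D\<in>\<C>. real (card {p \<in> roots r w \<tau> (C \<union> D). snd p ` C = D}) * F (\<C> - {D}))"
      using card_roots_insert_cycle[OF \<tau> finite_atLeastAtMost w sub \<C>(2)] by (simp add: F_def)
    show "F (insert C \<C>) = \<alpha> (cycle_type r w C) * F \<C> +
        (\<Sum>D\<in>\<C>. (if cycle_type r w D = cycle_type r w C then \<beta> (cycle_type r w C) else 0) * F (\<C> - {D}))"
      unfolding rec C by (intro arg_cong2[where f = "(+)"] refl sum.cong) (simp only: D)
  qed (use V(1) finite_cycles weight_0 in auto)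
  then show ?thesis
    by (simp add: F_def Union_cycles[OF \<tau>] sqrt_count_eq_roots[OF g] cyc_mult_eq case_prod_unfold)
qed

subsection \<open>Coefficients of the multivariate product\<close>

text \<open>The series with coefficients \<open>h\<close> in the single variable x_v: the common
  shape of the factors built from D and from R.\<close>

definition univariate :: "nat \<times> nat \<Rightarrow> (nat \<Rightarrow> real) \<Rightarrow> mps" where
  "univariate v h m = (if m = Poly_Mapping.single v (Poly_Mapping.lookup m v) then h (Poly_Mapping.lookup m v) else 0)"

text \<open>\<open>mps_mult\<close> sums over this set, and a sum over an infinite set would be 0 by
  convention. Both summands are bounded pointwise by \<open>m\<close>, hence supported on its
  keys.\<close>

lemma finite_decompositions: "finite {p :: ('a \<Rightarrow>\<^sub>0 nat) \<times> ('a \<Rightarrow>\<^sub>0 nat). fst p + snd p = m}"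
proof -
  \<comment> \<open>The inserted 0 keeps the maximum defined for the empty monomial.\<close>
  let ?B = "Max (insert 0 (Poly_Mapping.lookup m ` Poly_Mapping.keys m))"
  let ?S = "{f. \<forall>x. (x \<in> Poly_Mapping.keys m \<longrightarrow> f x \<in> {..?B}) \<and> (x \<notin> Poly_Mapping.keys m \<longrightarrow> f x = (0::nat))}"
  have S: "finite ?S" by (rule finite_set_of_finite_funs) simp_all
  have mem: "Poly_Mapping.lookup p \<in> ?S" if "\<And>x. Poly_Mapping.lookup p x \<le> Poly_Mapping.lookup m x" for p
  proof -
    have "Poly_Mapping.lookup p x \<le> ?B" if "x \<in> Poly_Mapping.keys m" for x
    proof -
      have "Poly_Mapping.lookup m x \<le> ?B" by (rule Max_ge) (use that in auto)
      then show ?thesis using \<open>\<And>x. Poly_Mapping.lookup p x \<le> Poly_Mapping.lookup m x\<close>[of x] by linarith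
    qed
    moreover have "Poly_Mapping.lookup p x = 0" if "x \<notin> Poly_Mapping.keys m" for x
      using \<open>\<And>x. Poly_Mapping.lookup p x \<le> Poly_Mapping.lookup m x\<close>[of x] that by (simp add: in_keys_iff)
    ultimately show ?thesis by simp
  qed
  have "inj_on (\<lambda>p. (Poly_Mapping.lookup (fst p), Poly_Mapping.lookup (snd p))) {p :: ('a \<Rightarrow>\<^sub>0 nat) \<times> ('a \<Rightarrow>\<^sub>0 nat). fst p + snd p = m}"
    by (auto simp: inj_on_def lookup_inject)
  moreover have "(\<lambda>p. (Poly_Mapping.lookup (fst p), Poly_Mapping.lookup (snd p))) ` {p. fst p + snd p = m} \<subseteq> ?S \<times> ?S"
  proof (rule image_subsetI)
    fix p :: "('a \<Rightarrow>\<^sub>0 nat) \<times> ('a \<Rightarrow>\<^sub>0 nat)" assume "p \<in> {p. fst p + snd p = m}"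
    then have "\<And>x. Poly_Mapping.lookup m x = Poly_Mapping.lookup (fst p) x + Poly_Mapping.lookup (snd p) x" by (auto simp: lookup_add)
    then show "(Poly_Mapping.lookup (fst p), Poly_Mapping.lookup (snd p)) \<in> ?S \<times> ?S"
      using mem[of "fst p"] mem[of "snd p"] by simp
  qed
  ultimately show ?thesis using finite_cartesian_product[OF S S] by (rule inj_on_finite)
qed

text \<open>With distinct variables at most one decomposition of \<open>m\<close> contributes: the
  first factor takes exactly the power of its own variable, and the other factors take the
  rest.\<close>

lemma mps_listprod_univariate:
  assumes "distinct vs"
  shows "mps_listprod (map (\<lambda>v. univariate v (h v)) vs) m =
    (if Poly_Mapping.keys m \<subseteq> set vs then \<Prod>v\<in>set vs. h v (Poly_Mapping.lookup m v) else 0)"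
  using assms
proof (induction vs arbitrary: m)
  case Nil
  then show ?case by (auto simp: mps_one_def)
next
  case (Cons v vs)
  let ?G = "mps_listprod (map (\<lambda>v. univariate v (h v)) vs)"
  have IH: "?G q = (if Poly_Mapping.keys q \<subseteq> set vs then \<Prod>v\<in>set vs. h v (Poly_Mapping.lookup q v) else 0)" for q
    using Cons by simp
  have v: "v \<notin> set vs" using Cons.prems by simp
  define s where "s = Poly_Mapping.single v (Poly_Mapping.lookup m v)"
  define q where "q = m - s"
  have lq: "Poly_Mapping.lookup q u = (if u = v then 0 else Poly_Mapping.lookup m u)" for u
    by (simp add: q_def s_def lookup_minus lookup_single when_def)
  have sq: "s + q = m"
    by (rule poly_mapping_eqI) (simp add: lookup_add lq s_def lookup_single when_def)
  have kq: "Poly_Mapping.keys q = Poly_Mapping.keys m - {v}" by (auto simp: in_keys_iff lq split: if_splits)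
  have zero: "univariate v (h v) (fst p) * ?G (snd p) = 0" if p: "fst p + snd p = m" "p \<noteq> (s, q)" for p
  proof (rule ccontr)
    assume nz: "univariate v (h v) (fst p) * ?G (snd p) \<noteq> 0"
    then have fs: "fst p = Poly_Mapping.single v (Poly_Mapping.lookup (fst p) v)" and ks: "Poly_Mapping.keys (snd p) \<subseteq> set vs"
      by (auto simp: univariate_def IH split: if_splits)
    have "Poly_Mapping.lookup (snd p) v = 0" using ks v by (auto simp: in_keys_iff)
    then have "Poly_Mapping.lookup (fst p) v = Poly_Mapping.lookup m v" using p(1) by (auto simp: lookup_add)
    then have "fst p = s" using fs by (simp add: s_def)
    moreover then have "snd p = q" using p(1) sq by (metis add_left_cancel)
    ultimately show False using p(2) by (metis prod.collapse)
  qed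
  have "mps_listprod (map (\<lambda>v. univariate v (h v)) (v # vs)) m =
      (\<Sum>p\<in>{p. fst p + snd p = m}. univariate v (h v) (fst p) * ?G (snd p))"
    by (simp add: mps_mult_def)
  also have "\<dots> = (\<Sum>p\<in>{(s, q)}. univariate v (h v) (fst p) * ?G (snd p))"
    by (rule sum.mono_neutral_right[OF finite_decompositions]) (use sq zero in auto)
  also have "\<dots> = h v (Poly_Mapping.lookup m v) * ?G q"
    by (simp add: univariate_def s_def)
  also have "?G q = (if Poly_Mapping.keys m \<subseteq> set (v # vs) then \<Prod>u\<in>set vs. h u (Poly_Mapping.lookup m u) else 0)"
  proof -
    have "(\<Prod>u\<in>set vs. h u (Poly_Mapping.lookup q u)) = (\<Prod>u\<in>set vs. h u (Poly_Mapping.lookup m u))"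
      by (rule prod.cong) (use v in \<open>auto simp: lq\<close>)
    moreover have "Poly_Mapping.keys q \<subseteq> set vs \<longleftrightarrow> Poly_Mapping.keys m \<subseteq> set (v # vs)" unfolding kq by auto
    ultimately show ?thesis unfolding IH by (simp only:)
  qed
  finally show ?case using v by simp
qed

lemma mps_sub_fpsD:
  assumes "even j \<or> even r \<and> odd t"
  shows "mps_sub fpsD (real (j * r)) (t, j) 2 = univariate (t, j) (weight r (t, j))"
  using assms by (auto simp: mps_sub_def univariate_def weight_def fpsD_def fun_eq_iff)

lemma mps_sub_fpsR_odd:
  assumes "odd j" "odd r"
  shows "mps_sub (fpsR (real (r * j))) 1 (t, j) 1 = univariate (t, j) (weight r (t, j))"
  using assms by (auto simp: mps_sub_def univariate_def weight_def fpsR_def fun_eq_iff)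

lemma mps_sub_fpsR_even:
  assumes "odd j" "even r" "even t"
  shows "mps_sub (fpsR (real (r * j) / 4)) 2 (t, j) 1 = univariate (t, j) (weight r (t, j))"
  using assms by (auto simp: mps_sub_def univariate_def weight_def fpsR_def fun_eq_iff)

text \<open>The variable of each factor, in the order in which \<open>factors1\<close> lists the
  factors, so that the two lists correspond entry by entry.\<close>

definition factor_vars :: "nat \<Rightarrow> nat \<Rightarrow> (nat \<times> nat) list" where
  "factor_vars r k = (if odd r then concat (map (\<lambda>t. [(t, 2 * k), (t, 2 * k - 1)]) [0..<r])
     else map (\<lambda>t. (t, 2 * k)) [0..<r] @ map (\<lambda>t. (t, 2 * k - 1)) (filter odd [0..<r])
       @ map (\<lambda>t. (t, 2 * k - 1)) (filter even [0..<r]))"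

lemma factors1_eq:
  assumes "k \<ge> 1"
  shows "factors1 r k = map (\<lambda>v. univariate v (weight r v)) (factor_vars r k)"
proof -
  \<comment> \<open>Here \<open>k \<ge> 1\<close> matters: for \<open>k = 0\<close> truncated
    subtraction gives 0, which is even.\<close>
  have o: "odd (2 * k - 1)" using assms by simp
  have e: "mps_sub fpsD (real (2 * k * r)) (t, 2 * k) 2 = univariate (t, 2 * k) (weight r (t, 2 * k))" for t
    by (rule mps_sub_fpsD) simp
  show ?thesis
  proof (cases "odd r")
    case True
    then show ?thesis
      unfolding factors1_def factor_vars_def e mps_sub_fpsR_odd[OF o True]
      by (simp add: map_concat comp_def)
  next
    case False
    have "map (\<lambda>t. mps_sub fpsD (real ((2 * k - 1) * r)) (t, 2 * k - 1) 2) (filter odd [0..<r]) =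
        map (\<lambda>t. univariate (t, 2 * k - 1) (weight r (t, 2 * k - 1))) (filter odd [0..<r])"
      by (rule map_cong[OF refl], rule mps_sub_fpsD) (use False in simp)
    moreover have "map (\<lambda>t. mps_sub (fpsR (real (r * (2 * k - 1)) / 4)) 2 (t, 2 * k - 1) 1) (filter even [0..<r]) =
        map (\<lambda>t. univariate (t, 2 * k - 1) (weight r (t, 2 * k - 1))) (filter even [0..<r])"
      by (rule map_cong[OF refl], rule mps_sub_fpsR_even[OF o]) (use False in simp_all)
    ultimately show ?thesis
      using False unfolding factors1_def factor_vars_def e by (simp only: if_False map_append map_map comp_def)
  qed
qed

lemma length_factor_vars: "length (factor_vars r k) = 2 * r"
proof (cases "odd r")
  case True
  then show ?thesis by (simp add: factor_vars_def length_concat comp_def sum_list_triv)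
next
  case False
  then show ?thesis
    using sum_length_filter_compl[of odd "[0..<r]"] by (simp add: factor_vars_def)
qed

lemma set_factor_vars: "set (factor_vars r k) = {..<r} \<times> {2 * k - 1, 2 * k}"
  by (auto simp: factor_vars_def)

lemma set_all_factor_vars:
  "set (concat (map (factor_vars r) [1..<K + 1])) = {..<r} \<times> {1..2 * K}"
proof (induction K)
  case (Suc K)
  have "{1..2 * Suc K} = {1..2 * K} \<union> {2 * Suc K - 1, 2 * Suc K}" by auto
  then have "{..<r} \<times> {1..2 * Suc K} = {..<r} \<times> {1..2 * K} \<union> set (factor_vars r (Suc K))"
    unfolding set_factor_vars by (simp only: Sigma_Un_distrib2)
  then show ?case unfolding Suc[symmetric] by simp
qed simp

text \<open>By counting: the list has 2 r K entries, and so many elements has its set, the full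
  rectangle of types up to length 2K.\<close>

lemma distinct_all_factor_vars: "distinct (concat (map (factor_vars r) [1..<K + 1]))"
proof (rule card_distinct)
  have "length (concat (map (factor_vars r) [1..<K + 1])) = 2 * r * K"
    by (induction K) (simp_all add: length_factor_vars)
  then show "card (set (concat (map (factor_vars r) [1..<K + 1]))) = length (concat (map (factor_vars r) [1..<K + 1]))"
    unfolding set_all_factor_vars by (simp add: card_cartesian_product)
qed

lemma partial1_eq:
  "partial1 r K m = (if Poly_Mapping.keys m \<subseteq> {..<r} \<times> {1..2 * K} then \<Prod>v\<in>{..<r} \<times> {1..2 * K}. weight r v (Poly_Mapping.lookup m v) else 0)"
proof -
  have "concat (map (factors1 r) [1..<K + 1]) =
      map (\<lambda>v. univariate v (weight r v)) (concat (map (factor_vars r) [1..<K + 1]))"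
    unfolding map_concat map_map 
    by (rule arg_cong[where f = concat], rule map_cong[OF refl]) (auto simp: factors1_eq)
  then show ?thesis
    unfolding partial1_def
    by (simp only: mps_listprod_univariate[OF distinct_all_factor_vars] set_all_factor_vars)
qed

lemma lookup_cycle_monomial:
  assumes "(w, \<tau>) \<in> Gr r n" "r \<ge> 1"
  shows "Poly_Mapping.lookup (cycle_monomial r n (w, \<tau>)) (t, j) = cyc_mult r n (w, \<tau>) t j"
proof -
  let ?f = "\<lambda>(t, j). if t < r \<and> j \<in> {1..n} then cyc_mult r n (w, \<tau>) t j else 0"
  have "finite {x. ?f x \<noteq> 0}"
    by (rule finite_subset[of _ "{..<r} \<times> {1..n}"]) (auto split: if_splits)
  then have "Poly_Mapping.lookup (cycle_monomial r n (w, \<tau>)) = ?f"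
    unfolding cycle_monomial_def by (rule lookup_Abs_poly_mapping)
  then show ?thesis using cyc_mult_eq_0[OF assms, of t j] by auto
qed

lemma partial1_cycle_monomial:
  assumes g: "(w, \<tau>) \<in> Gr r n" and r: "r \<ge> 1" and "n \<le> 2 * K"
  shows "partial1 r K (cycle_monomial r n (w, \<tau>)) = real (sqrt_count r n (w, \<tau>))"
proof -
  let ?m = "cycle_monomial r n (w, \<tau>)"
  have "Poly_Mapping.keys ?m \<subseteq> {..<r} \<times> {1..2 * K}"
  proof
    fix v assume "v \<in> Poly_Mapping.keys ?m"
    then have "cyc_mult r n (w, \<tau>) (fst v) (snd v) \<noteq> 0"
      using lookup_cycle_monomial[OF g r, of "fst v" "snd v"] by (simp add: in_keys_iff)
    then have "(fst v, snd v) \<in> {..<r} \<times> {1..n}" 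
      using cyc_mult_eq_0[OF g r, of "fst v" "snd v"] by metis
    then show "v \<in> {..<r} \<times> {1..2 * K}" using assms(3) by (cases v) auto
  qed
  moreover have "real (sqrt_count r n (w, \<tau>)) =
      (\<Prod>(t, j)\<in>{..<r} \<times> {1..2 * K}. weight r (t, j) (cyc_mult r n (w, \<tau>) t j))"
    by (rule sqrt_count_eq_prod_weight[OF g r]) (use assms(3) in auto)
  ultimately show ?thesis
    by (simp add: partial1_eq case_prod_unfold flip: lookup_cycle_monomial[OF g r])
qed

subsection \<open>Coefficients of the univariate product\<close>

lemma fps_compose_monom_nth:
  fixes f :: "'a::field fps"
  assumes "d > 0"
  shows "fps_nth (f oo (fps_const c * fps_X ^ d)) i =
    (if d dvd i then fps_nth f (i div d) * c ^ (i div d) else 0)"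
proof -
  have "fps_nth ((fps_const c * fps_X ^ d) ^ k) i = (if i = d * k then c ^ k else 0)" for k
    by (simp add: power_mult_distrib fps_const_power fps_mult_left_const_nth fps_X_power_nth
        flip: power_mult)
  then have "fps_nth (f oo (fps_const c * fps_X ^ d)) i =
      (\<Sum>k=0..i. if i = d * k then fps_nth f k * c ^ k else 0)"
    unfolding fps_compose_nth by (intro sum.cong) auto
  also have "\<dots> = (\<Sum>k=0..i. if k = i div d then (if d dvd i then fps_nth f k * c ^ k else 0) else 0)"
    by (rule sum.cong) (use assms in auto)
  also have "\<dots> = (if d dvd i then fps_nth f (i div d) * c ^ (i div d) else 0)"
    by (simp add: sum.delta)
  finally show ?thesis .
qed

text \<open>The series h(x^j), which is what \<open>univariate (t, j) h\<close> becomes when x^j is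
  substituted for x_{t,j}.\<close>

definition dilate :: "nat \<Rightarrow> (nat \<Rightarrow> real) \<Rightarrow> real fps" where
  "dilate j h = Abs_fps (\<lambda>i. if j dvd i then h (i div j) else 0)"

lemma dilate_nth: "fps_nth (dilate j h) i = (if j dvd i then h (i div j) else 0)"
  by (simp add: dilate_def)

lemma compose_fpsD_eq_dilate:
  assumes "even j \<or> even r \<and> odd t" "j > 0"
  shows "fpsD oo (fps_const (real (j * r)) * fps_X ^ (2 * j)) = dilate j (weight r (t, j))"
proof (rule fps_ext)
  fix i
  have "2 * j dvd i \<longleftrightarrow> j dvd i \<and> even (i div j)"
    using assms(2) by (auto simp: dvd_div_iff_mult mult.commute intro: dvd_mult_left elim!: dvdE)
  moreover have "i div (2 * j) = i div j div 2"
    by (simp add: div_mult2_eq mult.commute)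
  ultimately show "fps_nth (fpsD oo (fps_const (real (j * r)) * fps_X ^ (2 * j))) i =
      fps_nth (dilate j (weight r (t, j))) i"
    using assms by (simp add: fps_compose_monom_nth dilate_def weight_def fpsD_def)
qed

lemma compose_fpsR_odd_eq_dilate:
  assumes "odd j" "odd r"
  shows "fpsR (real (r * j)) oo fps_X ^ j = dilate j (weight r (t, j))"
proof -
  have "j > 0" using assms(1) by (rule odd_pos)
  then show ?thesis
    using fps_compose_monom_nth[of j "fpsR (real (r * j))" 1] assms
    by (auto simp: fps_eq_iff dilate_def weight_def fpsR_def)
qed

lemma compose_fpsR_even_eq_dilate:
  assumes "odd j" "even r" "even t"
  shows "fpsR (real (r * j) / 4) oo (fps_const 2 * fps_X ^ j) = dilate j (weight r (t, j))"
proof -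
  have "j > 0" using assms(1) by (rule odd_pos)
  then show ?thesis
    using assms by (auto simp: fps_eq_iff fps_compose_monom_nth dilate_def weight_def fpsR_def)
qed

text \<open>For even \<open>r\<close> the indices pair off as 2k, 2k + 1; this produces the
  exponents r/2 in the class-sum series.\<close>

lemma prod_parity_split:
  fixes f :: "nat \<Rightarrow> 'a::comm_monoid_mult"
  assumes "even r" and "\<And>t. t < r \<Longrightarrow> odd t \<Longrightarrow> f t = a" and "\<And>t. t < r \<Longrightarrow> even t \<Longrightarrow> f t = b"
  shows "(\<Prod>t<r. f t) = a ^ (r div 2) * b ^ (r div 2)"
proof -
  obtain h where h: "r = 2 * h" using assms(1) by blast
  have "(\<Prod>t<2 * k. f t) = a ^ k * b ^ k" if "k \<le> h" for k
    using that
  proof (induction k)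
    case (Suc k)
    then have "f (2 * k) = b" "f (Suc (2 * k)) = a" using assms h by auto
    then show ?case using Suc by (simp add: mult_ac)
  qed simp
  then show ?thesis using h by simp
qed

lemma gen_factor_eq:
  assumes "k \<ge> 1"
  shows "gen_factor r k = (\<Prod>v\<in>{..<r} \<times> {2 * k - 1, 2 * k}. dilate (snd v) (weight r v))"
proof -
  have o: "odd (2 * k - 1)" using assms by simp
  have e: "(\<Prod>t<r. dilate (2 * k) (weight r (t, 2 * k))) =
      (fpsD oo (fps_const (real (2 * k * r)) * fps_X ^ (4 * k))) ^ r"
  proof -
    have "dilate (2 * k) (weight r (t, 2 * k)) = fpsD oo (fps_const (real (2 * k * r)) * fps_X ^ (4 * k))" for t
      using compose_fpsD_eq_dilate[of "2 * k" r t] assms by (simp add: mult.assoc[symmetric])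
    then show ?thesis by simp
  qed
  have "(\<Prod>v\<in>{..<r} \<times> {2 * k - 1, 2 * k}. dilate (snd v) (weight r v)) =
      (\<Prod>t<r. \<Prod>j\<in>{2 * k - 1, 2 * k}. dilate j (weight r (t, j)))"
    by (subst prod.cartesian_product) (simp add: case_prod_unfold)
  also have "\<dots> = (\<Prod>t<r. dilate (2 * k - 1) (weight r (t, 2 * k - 1)) * dilate (2 * k) (weight r (t, 2 * k)))"
  proof (rule prod.cong[OF refl])
    fix t
    have "2 * k - 1 \<noteq> 2 * k" using assms by simp
    then show "(\<Prod>j\<in>{2 * k - 1, 2 * k}. dilate j (weight r (t, j))) =
        dilate (2 * k - 1) (weight r (t, 2 * k - 1)) * dilate (2 * k) (weight r (t, 2 * k))" by simp
  qed
  also have "\<dots> = (\<Prod>t<r. dilate (2 * k - 1) (weight r (t, 2 * k - 1))) *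
      (fpsD oo (fps_const (real (2 * k * r)) * fps_X ^ (4 * k))) ^ r"
    unfolding prod.distrib e ..
  finally have *: "(\<Prod>v\<in>{..<r} \<times> {2 * k - 1, 2 * k}. dilate (snd v) (weight r v)) = \<dots>" .
  show ?thesis
  proof (cases "odd r")
    case True
    have "(\<Prod>t<r. dilate (2 * k - 1) (weight r (t, 2 * k - 1))) =
        (fpsR (real (r * (2 * k - 1))) oo fps_X ^ (2 * k - 1)) ^ r"
      unfolding compose_fpsR_odd_eq_dilate[OF o True, symmetric] by simp
    then show ?thesis unfolding * gen_factor_def using True by (simp add: mult.commute)
  next
    case False
    then have er: "even r" by simp
    have "(\<Prod>t<r. dilate (2 * k - 1) (weight r (t, 2 * k - 1))) =
        (fpsD oo (fps_const (real ((2 * k - 1) * r)) * fps_X ^ (4 * k - 2))) ^ (r div 2) *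
        (fpsR (real (r * (2 * k - 1)) / 4) oo (fps_const 2 * fps_X ^ (2 * k - 1))) ^ (r div 2)"
    proof (rule prod_parity_split[OF er])
      fix t :: nat assume "odd t"
      then have "fpsD oo (fps_const (real ((2 * k - 1) * r)) * fps_X ^ (2 * (2 * k - 1))) =
          dilate (2 * k - 1) (weight r (t, 2 * k - 1))"
        by (intro compose_fpsD_eq_dilate) (use er assms in auto)
      moreover have "2 * (2 * k - 1) = 4 * k - 2" using assms by simp
      ultimately show "dilate (2 * k - 1) (weight r (t, 2 * k - 1)) =
          fpsD oo (fps_const (real ((2 * k - 1) * r)) * fps_X ^ (4 * k - 2))"
        by (simp only:)
    next
      fix t :: nat assume "even t"
      then show "dilate (2 * k - 1) (weight r (t, 2 * k - 1)) =
          fpsR (real (r * (2 * k - 1)) / 4) oo (fps_const 2 * fps_X ^ (2 * k - 1))"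
        by (rule compose_fpsR_even_eq_dilate[OF o er, symmetric])
    qed
    then show ?thesis unfolding * gen_factor_def using False by (simp only: if_False mult_ac)
  qed
qed

lemma prod_gen_factor_eq:
  "(\<Prod>k\<in>{1..K}. gen_factor r k) = (\<Prod>v\<in>{..<r} \<times> {1..2 * K}. dilate (snd v) (weight r v))"
proof (induction K)
  case (Suc K)
  have "{1..2 * Suc K} = {1..2 * K} \<union> {2 * Suc K - 1, 2 * Suc K}" by auto
  then have U: "{..<r} \<times> {1..2 * Suc K} = {..<r} \<times> {1..2 * K} \<union> {..<r} \<times> {2 * Suc K - 1, 2 * Suc K}"
    by (simp only: Sigma_Un_distrib2)
  have "(\<Prod>v\<in>{..<r} \<times> {1..2 * Suc K}. dilate (snd v) (weight r v)) =
      (\<Prod>v\<in>{..<r} \<times> {1..2 * K}. dilate (snd v) (weight r v)) *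
      (\<Prod>v\<in>{..<r} \<times> {2 * Suc K - 1, 2 * Suc K}. dilate (snd v) (weight r v))"
    unfolding U by (rule prod.union_disjoint) auto
  also have "(\<Prod>v\<in>{..<r} \<times> {2 * Suc K - 1, 2 * Suc K}. dilate (snd v) (weight r v)) = gen_factor r (Suc K)"
    by (rule gen_factor_eq[symmetric]) simp
  finally show ?case using Suc by simp
qed simp

text \<open>Multipartite partitions of \<open>n\<close> in frequency notation with parts of types in
  \<open>V\<close>. Vanishing off \<open>V\<close> gives each partition exactly one
  function.\<close>

definition type_funs :: "(nat \<times> nat) set \<Rightarrow> nat \<Rightarrow> (nat \<times> nat \<Rightarrow> nat) set" where
  "type_funs V n = {m. (\<forall>v. v \<notin> V \<longrightarrow> m v = 0) \<and> (\<Sum>v\<in>V. snd v * m v) = n}"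

lemma finite_type_funs:
  assumes "finite V" "\<And>v. v \<in> V \<Longrightarrow> snd v > 0"
  shows "finite (type_funs V n)"
proof (rule finite_subset)
  show "type_funs V n \<subseteq> {m. \<forall>v. (v \<in> V \<longrightarrow> m v \<in> {..n}) \<and> (v \<notin> V \<longrightarrow> m v = 0)}"
  proof
    fix m assume m: "m \<in> type_funs V n"
    have "m v \<le> n" if v: "v \<in> V" for v
    proof -
      have "m v \<le> snd v * m v" using assms(2)[OF v] by simp
      also have "\<dots> \<le> (\<Sum>v\<in>V. snd v * m v)" by (rule member_le_sum[OF v]) (use assms(1) in auto)
      finally show ?thesis using m by (simp add: type_funs_def)
    qed
    then show "m \<in> {m. \<forall>v. (v \<in> V \<longrightarrow> m v \<in> {..n}) \<and> (v \<notin> V \<longrightarrow> m v = 0)}"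
      using m by (simp add: type_funs_def)
  qed
qed (rule finite_set_of_finite_funs[OF assms(1)], simp)

text \<open>Expanding the product means choosing a term x^(j a) from each factor; the exponent a is
  the multiplicity of that type, and the degrees must add up to \<open>n\<close>.\<close>

lemma prod_dilate_nth:
  assumes "finite V" "\<And>v. v \<in> V \<Longrightarrow> snd v > 0"
  shows "fps_nth (\<Prod>v\<in>V. dilate (snd v) (h v)) n = (\<Sum>m\<in>type_funs V n. \<Prod>v\<in>V. h v (m v))"
  using assms
proof (induction V arbitrary: n rule: finite_induct)
  case empty
  have "type_funs {} n = (if n = 0 then {\<lambda>_. 0} else {})"
    by (auto simp: type_funs_def)
  then show ?case by simp
next
  case (insert v V)
  define j where "j = snd v"
  have j: "j > 0" using insert.prems by (simp add: j_def)
  have pos: "\<And>v. v \<in> V \<Longrightarrow> snd v > 0" using insert.prems by simp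
  let ?P = "\<lambda>m. \<Prod>u\<in>V. h u (m u)"
  have "fps_nth (\<Prod>v\<in>insert v V. dilate (snd v) (h v)) n =
      (\<Sum>i=0..n. fps_nth (dilate j (h v)) i * fps_nth (\<Prod>v\<in>V. dilate (snd v) (h v)) (n - i))"
    using insert.hyps by (simp add: fps_mult_nth j_def)
  also have "\<dots> = (\<Sum>i=0..n. if j dvd i then h v (i div j) * (\<Sum>m\<in>type_funs V (n - i). ?P m) else 0)"
    by (intro sum.cong) (auto simp: dilate_nth insert.IH[OF pos])
  also have "\<dots> = (\<Sum>i\<in>{i\<in>{0..n}. j dvd i}. h v (i div j) * (\<Sum>m\<in>type_funs V (n - i). ?P m))"
    by (rule sum.inter_filter[symmetric]) simp
  \<comment> \<open>Only multiples i = j a of the part size contribute, so the sum is taken over the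
    multiplicity a instead.\<close>
  also have "\<dots> = (\<Sum>a\<in>{a. j * a \<le> n}. h v a * (\<Sum>m\<in>type_funs V (n - j * a). ?P m))"
    by (rule sum.reindex_bij_witness[of _ "\<lambda>a. j * a" "\<lambda>i. i div j"]) (use j in auto)
  also have "\<dots> = (\<Sum>(a, m)\<in>(SIGMA a:{a. j * a \<le> n}. type_funs V (n - j * a)). h v a * ?P m)"
  proof (subst sum.Sigma[symmetric])
    have "a \<le> n" if "j * a \<le> n" for a
    proof -
      have "a \<le> j * a" using j by simp
      then show ?thesis using that by linarith
    qed
    then have "{a. j * a \<le> n} \<subseteq> {..n}" by auto
    then show "finite {a. j * a \<le> n}" by (rule finite_subset) simp
  qed (auto simp: sum_distrib_left finite_type_funs[OF insert.hyps(1) pos])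
  \<comment> \<open>A multiplicity function on the larger set is its value at \<open>v\<close>
    together with the function reset to 0 at \<open>v\<close>.\<close>
  also have "\<dots> = (\<Sum>m\<in>type_funs (insert v V) n. h v (m v) * ?P m)"
  proof (rule sum.reindex_bij_witness[of _ "\<lambda>m. (m v, m(v := 0))" "\<lambda>(a, m). m(v := a)"])
    have upd: "(\<Sum>u\<in>V. snd u * (m(v := a)) u) = (\<Sum>u\<in>V. snd u * m u)" for m a
      by (rule sum.cong) (use insert.hyps(2) in auto)
    have updP: "?P (m(v := a)) = ?P m" for m a
      by (rule prod.cong) (use insert.hyps(2) in auto)
    fix p assume p: "p \<in> (SIGMA a:{a. j * a \<le> n}. type_funs V (n - j * a))"
    obtain a m where am: "p = (a, m)" by (cases p)
    have m: "j * a \<le> n" "\<And>u. u \<notin> V \<Longrightarrow> m u = 0" "(\<Sum>u\<in>V. snd u * m u) = n - j * a"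
      using p by (auto simp: am type_funs_def)
    show "((case p of (a, m) \<Rightarrow> m(v := a)) v, (case p of (a, m) \<Rightarrow> m(v := a))(v := 0)) = p"
      using m(2)[OF insert.hyps(2)] by (simp add: am fun_upd_idem)
    have "(\<Sum>u\<in>insert v V. snd u * (m(v := a)) u) = j * a + (\<Sum>u\<in>V. snd u * (m(v := a)) u)"
      using insert.hyps by (simp add: j_def)
    also have "\<dots> = n" unfolding upd m(3) using m(1) by simp
    finally show "(case p of (a, m) \<Rightarrow> m(v := a)) \<in> type_funs (insert v V) n"
      using m(2) by (simp add: am type_funs_def)
    show "h v ((case p of (a, m) \<Rightarrow> m(v := a)) v) * ?P (case p of (a, m) \<Rightarrow> m(v := a)) =
        (case p of (a, m) \<Rightarrow> h v a * ?P m)"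
      by (simp only: am prod.case updP) simp
  next
    fix m assume m: "m \<in> type_funs (insert v V) n"
    have upd: "(\<Sum>u\<in>V. snd u * (m(v := 0)) u) = (\<Sum>u\<in>V. snd u * m u)"
      by (rule sum.cong) (use insert.hyps(2) in auto)
    have "j * m v + (\<Sum>u\<in>V. snd u * m u) = n"
      using m insert.hyps by (simp add: type_funs_def j_def)
    then have "j * m v \<le> n" "(\<Sum>u\<in>V. snd u * (m(v := 0)) u) = n - j * m v" unfolding upd by auto
    then show "(m v, m(v := 0)) \<in> (SIGMA a:{a. j * a \<le> n}. type_funs V (n - j * a))"
      using m by (simp add: type_funs_def)
    show "(case (m v, m(v := 0)) of (a, m) \<Rightarrow> m(v := a)) = m" by simp
  qed
  also have "\<dots> = (\<Sum>m\<in>type_funs (insert v V) n. \<Prod>v\<in>insert v V. h v (m v))"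
    using insert.hyps by simp
  finally show ?case .
qed

lemma prod_gen_factor_nth:
  "fps_nth (\<Prod>k\<in>{1..K}. gen_factor r k) n =
    (\<Sum>m\<in>type_funs ({..<r} \<times> {1..2 * K}) n. \<Prod>v\<in>{..<r} \<times> {1..2 * K}. weight r v (m v))"
  unfolding prod_gen_factor_eq by (rule prod_dilate_nth) auto

subsection \<open>Conjugacy classes\<close>

text \<open>\<rho> carries the cycles of \<tau> onto those of \<tau>'. Summing the colour equation
  over the image of a cycle, the contributions of \<open>y\<close> on both sides cancel, because
  \<tau>' permutes that image; the colour is therefore unchanged.\<close>

lemma cyc_mult_conj:
  assumes g: "(w, \<tau>) \<in> Gr r n" and g': "(w', \<tau>') \<in> Gr r n" and h: "(y, \<rho>) \<in> Gr r n"
    and conj: "Gmult r n (y, \<rho>) (w, \<tau>) = Gmult r n (w', \<tau>') (y, \<rho>)"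
  shows "cyc_mult r n (w, \<tau>) t j = cyc_mult r n (w', \<tau>') t j"
proof -
  have \<tau>: "\<tau> permutes {1..n}" and \<tau>': "\<tau>' permutes {1..n}" and \<rho>: "\<rho> permutes {1..n}"
    using g g' h by (auto simp: Gr_def)
  have comm: "\<rho> (\<tau> x) = \<tau>' (\<rho> x)" for x using conj by (auto simp: Gmult_def fun_eq_iff)
  have commk: "\<rho> ((\<tau> ^^ k) x) = (\<tau>' ^^ k) (\<rho> x)" for k x by (induction k) (simp_all add: comm)
  have col: "(y i + w (inv \<rho> i)) mod r = (w' i + y (inv \<tau>' i)) mod r" if "i \<in> {1..n}" for i
  proof -
    have "fst (Gmult r n (y, \<rho>) (w, \<tau>)) i = fst (Gmult r n (w', \<tau>') (y, \<rho>)) i" by (simp only: conj)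
    then show ?thesis using that by (simp add: Gmult_def)
  qed
  have image: "\<rho> ` cycle_of \<tau> a = cycle_of \<tau>' (\<rho> a)" for a
    unfolding cycle_of_def by (simp add: image_image commk)
  have cycles': "cycles \<tau>' n = (`) \<rho> ` cycles \<tau> n"
  proof -
    have "cycles \<tau>' n = cycle_of \<tau>' ` \<rho> ` {1..n}" by (simp only: cycles_def permutes_image[OF \<rho>])
    also have "\<dots> = (`) \<rho> ` cycles \<tau> n" by (simp only: cycles_def image_image image)
    finally show ?thesis .
  qed
  have type: "cycle_type r w' (\<rho> ` c) = cycle_type r w c" if c: "c \<in> cycles \<tau> n" for c
  proof -
    obtain a where a: "a \<in> {1..n}" "c = cycle_of \<tau> a" using c by (auto simp: cycles_def)
    let ?c = "\<rho> ` c"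
    have sub: "?c \<subseteq> {1..n}"
      using cycle_of_subset[OF \<tau> a(1)] permutes_image[OF \<rho>] a(2) by blast
    have inj: "inj \<rho>" "inj \<tau>'" using permutes_inj[OF \<rho>] permutes_inj[OF \<tau>'] by auto
    have img: "\<tau>' ` ?c = ?c"
      unfolding a(2) image by (rule permutes_image_cycle_of[OF \<tau>']) simp
    have "[(\<Sum>i\<in>?c. y i + w (inv \<rho> i)) = (\<Sum>i\<in>?c. w' i + y (inv \<tau>' i))] (mod r)"
      by (rule cong_sum) (use col sub in \<open>auto simp: cong_def\<close>)
    moreover have "(\<Sum>i\<in>?c. w (inv \<rho> i)) = (\<Sum>i\<in>c. w i)"
      using inj(1) by (subst sum.reindex) (auto simp: inj_on_def inj_def permutes_inverses[OF \<rho>])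
    moreover have "(\<Sum>i\<in>?c. y (inv \<tau>' i)) = (\<Sum>i\<in>?c. y i)"
    proof -
      have "(\<Sum>i\<in>\<tau>' ` ?c. y (inv \<tau>' i)) = (\<Sum>i\<in>?c. y i)"
        using inj(2) by (subst sum.reindex) (auto simp: inj_on_def inj_def permutes_inverses[OF \<tau>'])
      then show ?thesis by (simp only: img)
    qed
    ultimately have "[(\<Sum>i\<in>?c. y i) + (\<Sum>i\<in>c. w i) = (\<Sum>i\<in>?c. y i) + (\<Sum>i\<in>?c. w' i)] (mod r)"
      by (simp add: sum.distrib add.commute)
    then have "[(\<Sum>i\<in>c. w i) = (\<Sum>i\<in>?c. w' i)] (mod r)" by (simp only: cong_add_lcancel_nat)
    moreover have "card ?c = card c" by (rule card_image[OF inj_on_subset[OF inj(1) subset_UNIV]])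
    ultimately show ?thesis by (simp add: cycle_type_def cycle_color_def cong_def)
  qed
  have "{c \<in> cycles \<tau>' n. cycle_type r w' c = (t, j)} = (`) \<rho> ` {c \<in> cycles \<tau> n. cycle_type r w c = (t, j)}"
    unfolding cycles' using type by auto
  moreover have "inj_on ((`) \<rho>) {c \<in> cycles \<tau> n. cycle_type r w c = (t, j)}"
    using inj_image_eq_iff[OF permutes_inj[OF \<rho>]] by (auto simp: inj_on_def)
  ultimately show ?thesis unfolding cyc_mult_eq by (simp add: card_image)
qed

text \<open>Bijections between equinumerous fibres glue together. It serves to match the cycles of
  two elements so that lengths and colours agree.\<close>

lemma exists_bij_betw_fibres:
  assumes "finite A" "finite B" and "\<And>v. card {a\<in>A. f a = v} = card {b\<in>B. g b = v}"
  shows "\<exists>\<beta>. bij_betw \<beta> A B \<and> (\<forall>a\<in>A. g (\<beta> a) = f a)"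
proof -
  have "\<exists>\<beta>. bij_betw \<beta> {a\<in>A. f a = v} {b\<in>B. g b = v}" for v
    by (rule finite_same_card_bij) (use assms in auto)
  then obtain \<beta> where \<beta>: "\<And>v. bij_betw (\<beta> v) {a\<in>A. f a = v} {b\<in>B. g b = v}" by metis
  have mem: "\<beta> (f a) a \<in> B" "g (\<beta> (f a) a) = f a" if "a \<in> A" for a
    using bij_betw_apply[OF \<beta>[of "f a"], of a] that by auto
  have "bij_betw (\<lambda>a. \<beta> (f a) a) A B"
  proof (rule bij_betw_imageI)
    show "inj_on (\<lambda>a. \<beta> (f a) a) A"
    proof (rule inj_onI)
      fix a a' assume a: "a \<in> A" "a' \<in> A" "\<beta> (f a) a = \<beta> (f a') a'"
      then have "f a = f a'" using mem by metis
      then show "a = a'"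
        using a bij_betw_imp_inj_on[OF \<beta>[of "f a"]] by (auto simp: inj_on_def)
    qed
    show "(\<lambda>a. \<beta> (f a) a) ` A = B"
    proof
      show "B \<subseteq> (\<lambda>a. \<beta> (f a) a) ` A"
      proof
        fix b assume "b \<in> B"
        then have "b \<in> \<beta> (g b) ` {a\<in>A. f a = g b}" using bij_betw_imp_surj_on[OF \<beta>[of "g b"]] by auto
        then show "b \<in> (\<lambda>a. \<beta> (f a) a) ` A" by force
      qed
    qed (use mem in auto)
  qed
  then show ?thesis using mem by auto
qed

text \<open>Cycles of equal type are matched by \<open>\<beta>\<close>, with base points
  \<open>a c\<close> and \<open>b c\<close>. Equal lengths allow \<rho> to send \<tau>^k (a c) to
  \<tau>'^k (b c), and equal colours allow the colour equation for the conjugating element to be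
  solved around each cycle.\<close>

lemma conj_if_same_cyc_mult:
  assumes g: "(w, \<tau>) \<in> Gr r n" and g': "(w', \<tau>') \<in> Gr r n" and r: "r \<ge> 1"
    and same: "\<And>t j. cyc_mult r n (w, \<tau>) t j = cyc_mult r n (w', \<tau>') t j"
  shows "\<exists>h\<in>Gr r n. Gmult r n h (w, \<tau>) = Gmult r n (w', \<tau>') h"
proof -
  have \<tau>: "\<tau> permutes {1..n}" and \<tau>': "\<tau>' permutes {1..n}" using g g' by (auto simp: Gr_def)
  have fin: "finite {1..n}" by simp
  note eq_iff = funpow_eq_iff_card[OF \<tau> fin] and eq_iff' = funpow_eq_iff_card[OF \<tau>' fin]
  have "card {c \<in> cycles \<tau> n. cycle_type r w c = v} = card {c \<in> cycles \<tau>' n. cycle_type r w' c = v}" for v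
    using same[of "fst v" "snd v"] by (simp add: cyc_mult_eq)
  from exists_bij_betw_fibres[OF finite_cycles finite_cycles this]
  obtain \<beta> where \<beta>: "bij_betw \<beta> (cycles \<tau> n) (cycles \<tau>' n)"
    "\<And>c. c \<in> cycles \<tau> n \<Longrightarrow> cycle_type r w' (\<beta> c) = cycle_type r w c" by blast
  have "\<forall>c\<in>cycles \<tau> n. \<exists>a. a \<in> {1..n} \<and> cycle_of \<tau> a = c" by (auto simp: cycles_def)
  then obtain a where a: "\<And>c. c \<in> cycles \<tau> n \<Longrightarrow> a c \<in> {1..n} \<and> cycle_of \<tau> (a c) = c" by metis
  have "\<forall>c\<in>cycles \<tau> n. \<exists>b. b \<in> {1..n} \<and> cycle_of \<tau>' b = \<beta> c"
  proof
    fix c assume "c \<in> cycles \<tau> n"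
    then have "\<beta> c \<in> cycles \<tau>' n" by (rule bij_betw_apply[OF \<beta>(1)])
    then show "\<exists>b. b \<in> {1..n} \<and> cycle_of \<tau>' b = \<beta> c" by (auto simp: cycles_def)
  qed
  then obtain b where b: "\<And>c. c \<in> cycles \<tau> n \<Longrightarrow> b c \<in> {1..n} \<and> cycle_of \<tau>' (b c) = \<beta> c" by metis
  have cardc: "card (cycle_of \<tau> (a c)) = card c" if "c \<in> cycles \<tau> n" for c using a[OF that] by simp
  have cardb: "card (cycle_of \<tau>' (b c)) = card c" if "c \<in> cycles \<tau> n" for c
    using b[OF that] \<beta>(2)[OF that] by (simp add: cycle_type_def)
  have cover: "\<exists>c k. c \<in> cycles \<tau> n \<and> i = (\<tau> ^^ k) (a c)" if "i \<in> {1..n}" for i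
  proof -
    have c: "cycle_of \<tau> i \<in> cycles \<tau> n" using that by (auto simp: cycles_def)
    then have "i \<in> cycle_of \<tau> (a (cycle_of \<tau> i))" using a[OF c] self_in_cycle_of[of i \<tau>] by simp
    then show ?thesis using c by (auto simp: cycle_of_def)
  qed
  have same_cycle: "c = c'" if "c \<in> cycles \<tau> n" "c' \<in> cycles \<tau> n" "(\<tau> ^^ k) (a c) = (\<tau> ^^ k') (a c')" for c c' k k'
  proof -
    have "cycle_of \<tau> ((\<tau> ^^ k) (a c)) = c" "cycle_of \<tau> ((\<tau> ^^ k') (a c')) = c'"
      using a[OF that(1)] a[OF that(2)] by (simp_all add: cycle_of_eq[OF \<tau> fin funpow_in_cycle_of])
    then show ?thesis using that(3) by simp
  qed
  have same_cycle': "c = c'" if "c \<in> cycles \<tau> n" "c' \<in> cycles \<tau> n" "(\<tau>' ^^ k) (b c) = (\<tau>' ^^ k') (b c')" for c c' k k'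
  proof -
    have "cycle_of \<tau>' ((\<tau>' ^^ k) (b c)) = \<beta> c" "cycle_of \<tau>' ((\<tau>' ^^ k') (b c')) = \<beta> c'"
      using b[OF that(1)] b[OF that(2)] by (simp_all add: cycle_of_eq[OF \<tau>' fin funpow_in_cycle_of])
    then show ?thesis using that bij_betw_imp_inj_on[OF \<beta>(1)] by (simp add: inj_on_def)
  qed

  have "\<exists>\<phi>. \<forall>p\<in>cycles \<tau> n \<times> UNIV. \<phi> ((\<tau> ^^ snd p) (a (fst p))) = (\<tau>' ^^ snd p) (b (fst p))"
  proof (rule exists_factor)
    fix p q assume pq: "p \<in> cycles \<tau> n \<times> (UNIV::nat set)" "q \<in> cycles \<tau> n \<times> (UNIV::nat set)"
      and e: "(\<tau> ^^ snd p) (a (fst p)) = (\<tau> ^^ snd q) (a (fst q))"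
    have p: "fst p \<in> cycles \<tau> n" "fst q \<in> cycles \<tau> n" using pq by auto
    have f: "fst p = fst q" by (rule same_cycle[OF p e])
    then show "(\<tau>' ^^ snd p) (b (fst p)) = (\<tau>' ^^ snd q) (b (fst q))"
      using e p(2) by (simp only: f eq_iff eq_iff' cardc cardb)
  qed
  then obtain \<phi> where \<phi>: "\<And>c k. c \<in> cycles \<tau> n \<Longrightarrow> \<phi> ((\<tau> ^^ k) (a c)) = (\<tau>' ^^ k) (b c)" by fastforce
  define \<rho> where "\<rho> = (\<lambda>i. if i \<in> {1..n} then \<phi> i else i)"
  have in_n: "(\<tau> ^^ k) (a c) \<in> {1..n}" "(\<tau>' ^^ k) (b c) \<in> {1..n}" if "c \<in> cycles \<tau> n" for c k
    using permutes_in_funpow_image[OF \<tau>] permutes_in_funpow_image[OF \<tau>'] a[OF that] b[OF that] by blast+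
  have \<rho>_eq: "\<rho> ((\<tau> ^^ k) (a c)) = (\<tau>' ^^ k) (b c)" if "c \<in> cycles \<tau> n" for c k
    using \<phi>[OF that] in_n(1)[OF that] by (simp add: \<rho>_def)
  have \<rho>: "\<rho> permutes {1..n}"
  proof (rule bij_imp_permutes)
    have inj: "inj_on \<rho> {1..n}"
    proof (rule inj_onI)
      fix i i' assume i: "i \<in> {1..n}" "i' \<in> {1..n}" "\<rho> i = \<rho> i'"
      obtain c k where ck: "c \<in> cycles \<tau> n" "i = (\<tau> ^^ k) (a c)" using cover[OF i(1)] by blast
      obtain c' k' where ck': "c' \<in> cycles \<tau> n" "i' = (\<tau> ^^ k') (a c')" using cover[OF i(2)] by blast
      have e: "(\<tau>' ^^ k) (b c) = (\<tau>' ^^ k') (b c')" using i(3) \<rho>_eq ck ck' by simp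
      have "c = c'" by (rule same_cycle'[OF ck(1) ck'(1) e])
      then show "i = i'" using e ck ck'(2) by (simp only: eq_iff eq_iff' cardc cardb)
    qed
    have "\<rho> ` {1..n} \<subseteq> {1..n}"
    proof (rule image_subsetI)
      fix i assume "i \<in> {1..n}"
      then obtain c k where ck: "c \<in> cycles \<tau> n" "i = (\<tau> ^^ k) (a c)" using cover by blast
      show "\<rho> i \<in> {1..n}" unfolding ck(2) \<rho>_eq[OF ck(1)] by (rule in_n(2)[OF ck(1)])
    qed
    then have "\<rho> ` {1..n} = {1..n}" using endo_inj_surj[OF fin _ inj] by blast
    then show "bij_betw \<rho> {1..n} {1..n}" using inj by (simp add: bij_betw_def)
  qed (auto simp: \<rho>_def)
  have comm: "\<rho> (\<tau> i) = \<tau>' (\<rho> i)" for i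
  proof (cases "i \<in> {1..n}")
    case True
    then obtain c k where ck: "c \<in> cycles \<tau> n" "i = (\<tau> ^^ k) (a c)" using cover by blast
    show ?thesis using \<rho>_eq[OF ck(1), of "Suc k"] \<rho>_eq[OF ck(1), of k] by (simp add: ck(2))
  next
    case False
    then show ?thesis
      using permutes_not_in[OF \<tau> False] permutes_not_in[OF \<tau>' False] permutes_not_in[OF \<rho> False] by simp
  qed

  \<comment> \<open>Colours of the conjugator by position, 0 at the base point: the equation
    y(\<rho> (\<tau> i)) - y(\<rho> i) = w'(\<rho> (\<tau> i)) - w(\<tau> i) prescribes each
    increment.\<close>
  define D where "D = (\<lambda>c k. \<Sum>i<k. int (w' ((\<tau>' ^^ Suc i) (b c))) - int (w ((\<tau> ^^ Suc i) (a c))))"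
  \<comment> \<open>The total increment over one turn is the difference of the two colour sums,
    which is 0 modulo \<open>r\<close> because the matched cycles have the same colour.\<close>
  have D_per: "D c (k + card c) mod int r = D c k mod int r" if c: "c \<in> cycles \<tau> n" for c k
  proof (induction k)
    case 0
    have "D c (card c) = int (\<Sum>u\<in>\<beta> c. w' u) - int (\<Sum>u\<in>c. w u)"
      using sum_cycle_of_Suc[OF \<tau> fin, of w "a c"] sum_cycle_of_Suc[OF \<tau>' fin, of w' "b c"] a[OF c] b[OF c]
        cardc[OF c] cardb[OF c] by (simp add: D_def sum_subtractf)
    moreover have "[int (\<Sum>u\<in>\<beta> c. w' u) = int (\<Sum>u\<in>c. w u)] (mod int r)"
      using \<beta>(2)[OF c] unfolding cong_int_iff by (simp add: cycle_type_def cycle_color_def cong_def)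
    ultimately have "D c (card c) mod int r = 0"
      by (simp only: cong_iff_dvd_diff mod_eq_0_iff_dvd)
    then show ?case by (simp add: D_def)
  next
    case (Suc k)
    have "(\<tau> ^^ Suc (k + card c)) (a c) = (\<tau> ^^ Suc k) (a c)"
      "(\<tau>' ^^ Suc (k + card c)) (b c) = (\<tau>' ^^ Suc k) (b c)"
      using mod_add_self2[of "Suc k" "card c"] by (simp_all only: eq_iff eq_iff' cardc[OF c] cardb[OF c] add_Suc)
    then have "D c (Suc k + card c) = D c (k + card c) + (D c (Suc k) - D c k)"
      by (simp only: D_def add_Suc sum.lessThan_Suc)
    also have "\<dots> mod int r = (D c k + (D c (Suc k) - D c k)) mod int r"
      by (rule mod_add_cong[OF Suc refl])
    finally show ?case by simp
  qed
  have "\<exists>\<psi>. \<forall>p\<in>cycles \<tau> n \<times> UNIV. \<psi> ((\<tau> ^^ snd p) (a (fst p))) = nat (D (fst p) (snd p) mod int r)"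
  proof (rule exists_factor)
    fix p q assume pq: "p \<in> cycles \<tau> n \<times> (UNIV::nat set)" "q \<in> cycles \<tau> n \<times> (UNIV::nat set)"
      and e: "(\<tau> ^^ snd p) (a (fst p)) = (\<tau> ^^ snd q) (a (fst q))"
    have p: "fst p \<in> cycles \<tau> n" "fst q \<in> cycles \<tau> n" using pq by auto
    have f: "fst p = fst q" by (rule same_cycle[OF p e])
    have "snd p mod card (fst q) = snd q mod card (fst q)" using e p(2) by (simp only: f eq_iff cardc)
    then have "D (fst q) (snd p) mod int r = D (fst q) (snd q) mod int r"
      by (rule periodic_mod_eq[of "\<lambda>k. D (fst q) k mod int r", OF D_per[OF p(2)]])
    then show "nat (D (fst p) (snd p) mod int r) = nat (D (fst q) (snd q) mod int r)" by (simp add: f)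
  qed
  then obtain \<psi> where \<psi>: "\<And>c k. c \<in> cycles \<tau> n \<Longrightarrow> \<psi> ((\<tau> ^^ k) (a c)) = nat (D c k mod int r)" by fastforce
  have \<psi>_lt: "\<psi> i < r" if "i \<in> {1..n}" for i
  proof -
    obtain c k where ck: "c \<in> cycles \<tau> n" "i = (\<tau> ^^ k) (a c)" using cover \<open>i \<in> {1..n}\<close> by blast
    show ?thesis unfolding ck(2) \<psi>[OF ck(1)] using r by (simp add: nat_less_iff)
  qed
  have \<psi>_step: "(\<psi> (\<tau> i) + w (\<tau> i)) mod r = (w' (\<rho> (\<tau> i)) + \<psi> i) mod r" if "i \<in> {1..n}" for i
  proof -
    obtain c k where ck: "c \<in> cycles \<tau> n" "i = (\<tau> ^^ k) (a c)" using cover \<open>i \<in> {1..n}\<close> by blast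
    have 1: "int (\<psi> (\<tau> i)) = D c (Suc k) mod int r" "int (\<psi> i) = D c k mod int r"
      using \<psi>[OF ck(1), of "Suc k"] \<psi>[OF ck(1), of k] r by (simp_all add: ck(2))
    have 2: "D c (Suc k) + int (w (\<tau> i)) = int (w' (\<rho> (\<tau> i))) + D c k"
      using \<rho>_eq[OF ck(1), of "Suc k"] by (simp add: D_def ck(2))
    have "int ((\<psi> (\<tau> i) + w (\<tau> i)) mod r) = (D c (Suc k) + int (w (\<tau> i))) mod int r"
      by (simp add: zmod_int 1 mod_add_left_eq)
    also have "\<dots> = int ((w' (\<rho> (\<tau> i)) + \<psi> i) mod r)"
      unfolding 2 by (simp add: zmod_int 1 mod_add_right_eq)
    finally show ?thesis by simp
  qed

  \<comment> \<open>\<open>\<psi>\<close> is indexed by the point before \<rho> is applied, a colour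
    of the conjugator by the point after.\<close>
  define y where "y = (\<lambda>i. if i \<in> {1..n} then \<psi> (inv \<rho> i) else 0)"
  have inv_in: "inv \<rho> i \<in> {1..n} \<longleftrightarrow> i \<in> {1..n}" for i
    by (rule permutes_in_image[OF permutes_inv[OF \<rho>]])
  have y\<rho>: "y (\<rho> i) = \<psi> i" if "i \<in> {1..n}" for i
    using that permutes_in_image[OF \<rho>, of i] permutes_inverses(2)[OF \<rho>] unfolding y_def by simp
  have "(y, \<rho>) \<in> Gr r n"
    using \<rho> \<psi>_lt inv_in by (auto simp: Gr_def y_def)
  moreover have "Gmult r n (y, \<rho>) (w, \<tau>) = Gmult r n (w', \<tau>') (y, \<rho>)"
  proof -
    have "(y i + w (inv \<rho> i)) mod r = (w' i + y (inv \<tau>' i)) mod r" if i: "i \<in> {1..n}" for i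
    proof -
      \<comment> \<open>Chosen so that i = \<rho> (\<tau> u): then the step equation for
        \<open>\<psi>\<close> at \<open>u\<close> is the required identity at
        \<open>i\<close>.\<close>
      define u where "u = inv \<tau> (inv \<rho> i)"
      have u: "u \<in> {1..n}"
        unfolding u_def by (simp only: permutes_in_image[OF permutes_inv[OF \<tau>]] inv_in i)
      have \<tau>u: "\<tau> u = inv \<rho> i" unfolding u_def by (rule permutes_inverses(1)[OF \<tau>])
      have i_eq: "i = \<rho> (\<tau> u)" unfolding \<tau>u by (rule permutes_inverses(1)[OF \<rho>, symmetric])
      have i': "inv \<tau>' i = \<rho> u" unfolding i_eq comm by (rule permutes_inverses(2)[OF \<tau>'])
      have "y i = \<psi> (\<tau> u)" using i by (simp add: y_def \<tau>u)
      then show ?thesis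
        using \<psi>_step[OF u] unfolding i' y\<rho>[OF u] \<tau>u permutes_inverses(1)[OF \<rho>] by simp
    qed
    then show ?thesis by (auto simp: Gmult_def comm fun_eq_iff)
  qed
  ultimately show ?thesis by blast
qed

text \<open>An element with prescribed cycles is assembled from abstract slots: their number is the
  weighted sum \<open>n\<close>, so they can be labelled by \<open>{1..n}\<close>, and the
  permutation advances cyclically inside each intended cycle.\<close>

lemma exists_with_cyc_mult:
  assumes m: "m \<in> type_funs V n" and V: "finite V" "V \<subseteq> {..<r} \<times> {1..}"
  shows "\<exists>g\<in>Gr r n. (\<lambda>(t, j). cyc_mult r n g t j) = m"
proof -
  \<comment> \<open>\<open>Q\<close> lists the intended cycles, each as a type with a copy number;
    \<open>E\<close> below adds a position along the cycle.\<close>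
  define Q where "Q = (SIGMA v:V. {..<m v})"
  define E where "E = (SIGMA q:Q. {..<snd (fst q)})"
  have finQ: "finite Q" using V(1) by (auto simp: Q_def)
  have finE: "finite E" using finQ by (auto simp: E_def)
  have len: "snd (fst q) > 0" and col: "fst (fst q) < r" if "q \<in> Q" for q
    using that V(2) by (auto simp: Q_def)
  have "card E = (\<Sum>q\<in>Q. snd (fst q))" unfolding E_def using finQ by (subst card_SigmaI) auto
  also have "\<dots> = (\<Sum>v\<in>V. \<Sum>i<m v. snd v)"
    unfolding Q_def by (subst sum.Sigma) (use V(1) in \<open>auto simp: case_prod_unfold\<close>)
  also have "\<dots> = n" using m by (simp add: type_funs_def mult.commute)
  finally have "\<exists>e. bij_betw e E {1..n}" by (intro finite_same_card_bij) (use finE in auto)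
  then obtain e where e: "bij_betw e E {1..n}" by blast
  define e' where "e' = inv_into E e"
  have e'e: "e' (e p) = p" if "p \<in> E" for p
    unfolding e'_def by (rule inv_into_f_f[OF bij_betw_imp_inj_on[OF e] that])
  have e_in: "e p \<in> {1..n}" if "p \<in> E" for p using bij_betw_apply[OF e that] .
  have E_mem: "(q, k) \<in> E \<longleftrightarrow> q \<in> Q \<and> k < snd (fst q)" for q k by (simp add: E_def)
  have e_ex: "\<exists>q k. q \<in> Q \<and> k < snd (fst q) \<and> i = e (q, k)" if "i \<in> {1..n}" for i
  proof -
    have "i \<in> e ` E" using that bij_betw_imp_surj_on[OF e] by simp
    then obtain p where p: "p \<in> E" "i = e p" by blast
    then show ?thesis using E_mem[of "fst p" "snd p"] by (intro exI[of _ "fst p"] exI[of _ "snd p"]) simp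
  qed
  define \<tau> where "\<tau> = (\<lambda>i. if i \<in> {1..n} then e (fst (e' i), Suc (snd (e' i)) mod snd (fst (fst (e' i)))) else i)"
  \<comment> \<open>The whole colour t of a cycle sits at its position 0, so its colour sum is t,
    already reduced modulo \<open>r\<close>.\<close>
  define w where "w = (\<lambda>i. if i \<in> {1..n} \<and> snd (e' i) = 0 then fst (fst (fst (e' i))) else 0)"
  have \<tau>_e: "\<tau> (e (q, k)) = e (q, Suc k mod snd (fst q))" if "q \<in> Q" "k < snd (fst q)" for q k
    using that e'e[of "(q, k)"] e_in[of "(q, k)"] by (simp add: \<tau>_def E_mem)
  have w_e: "w (e (q, k)) = (if k = 0 then fst (fst q) else 0)" if "q \<in> Q" "k < snd (fst q)" for q k
    using that e'e[of "(q, k)"] e_in[of "(q, k)"] by (auto simp: w_def E_mem)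
  have \<tau>: "\<tau> permutes {1..n}"
  proof (rule bij_imp_permutes)
    have img: "\<tau> ` {1..n} = {1..n}"
    proof
      show "\<tau> ` {1..n} \<subseteq> {1..n}"
      proof (rule image_subsetI)
        fix i assume "i \<in> {1..n}"
        then obtain q k where q: "q \<in> Q" "k < snd (fst q)" "i = e (q, k)" using e_ex by blast
        show "\<tau> i \<in> {1..n}" unfolding q(3) \<tau>_e[OF q(1,2)] by (rule e_in) (use q len in \<open>auto simp: E_mem\<close>)
      qed
      show "{1..n} \<subseteq> \<tau> ` {1..n}"
      proof
        fix i assume "i \<in> {1..n}"
        then obtain q k where q: "q \<in> Q" "k < snd (fst q)" "i = e (q, k)" using e_ex by blast
        \<comment> \<open>The predecessor position of \<open>k\<close>, wrapping to the last
          position when \<open>k\<close> is 0.\<close>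
        obtain k' where k': "k' < snd (fst q)" "Suc k' mod snd (fst q) = k"
        proof (cases k)
          case 0
          then show ?thesis using that[of "snd (fst q) - 1"] len[OF q(1)] by simp
        next
          case (Suc k'')
          then show ?thesis using that[of k''] q(2) by simp
        qed
        have "i = \<tau> (e (q, k'))" using \<tau>_e[OF q(1) k'(1)] k'(2) q(3) by simp
        moreover have "e (q, k') \<in> {1..n}" by (rule e_in) (use q k' in \<open>auto simp: E_mem\<close>)
        ultimately show "i \<in> \<tau> ` {1..n}" by blast
      qed
    qed
    then have "inj_on \<tau> {1..n}" by (intro eq_card_imp_inj_on) simp_all
    then show "bij_betw \<tau> {1..n} {1..n}" using img by (simp add: bij_betw_def)
  qed (auto simp: \<tau>_def)
  have g: "(w, \<tau>) \<in> Gr r n"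
    unfolding Gr_def
  proof (intro CollectI case_prodI conjI ballI allI impI)
    fix i assume "i \<in> {1..n}"
    then obtain q k where q: "q \<in> Q" "k < snd (fst q)" "i = e (q, k)" using e_ex by blast
    show "w i < r" unfolding q(3) w_e[OF q(1,2)] using col[OF q(1)] by simp
  qed (use \<tau> in \<open>auto simp: w_def\<close>)

  define cyc where "cyc = (\<lambda>q. (\<lambda>k. e (q, k)) ` {..<snd (fst q)})"
  have pow: "(\<tau> ^^ p) (e (q, 0)) = e (q, p mod snd (fst q))" if q: "q \<in> Q" for p q
  proof (induction p)
    case (Suc p)
    then show ?case using \<tau>_e[OF q, of "p mod snd (fst q)"] len[OF q] by (simp add: mod_Suc_eq)
  qed simp
  have cyc0: "cycle_of \<tau> (e (q, 0)) = cyc q" if q: "q \<in> Q" for q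
  proof -
    have "cycle_of \<tau> (e (q, 0)) = (\<lambda>k. e (q, k)) ` range (\<lambda>p. p mod snd (fst q))"
      by (simp only: cycle_of_def pow[OF q] image_image)
    also have "range (\<lambda>p. p mod snd (fst q)) = {..<snd (fst q)}"
      using len[OF q] by (auto simp: image_iff intro: mod_less[symmetric])
    finally show ?thesis by (simp add: cyc_def)
  qed
  have cycles: "cycles \<tau> n = cyc ` Q"
  proof
    show "cyc ` Q \<subseteq> cycles \<tau> n"
    proof (rule image_subsetI)
      fix q assume q: "q \<in> Q"
      have "e (q, 0) \<in> {1..n}" by (rule e_in) (use q len in \<open>auto simp: E_mem\<close>)
      then show "cyc q \<in> cycles \<tau> n" unfolding cyc0[OF q, symmetric] cycles_def by (rule imageI)
    qed
    show "cycles \<tau> n \<subseteq> cyc ` Q"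
    proof
      fix c assume "c \<in> cycles \<tau> n"
      then obtain i where i: "i \<in> {1..n}" "c = cycle_of \<tau> i" by (auto simp: cycles_def)
      then obtain q k where q: "q \<in> Q" "k < snd (fst q)" "i = e (q, k)" using e_ex by blast
      have "i \<in> cycle_of \<tau> (e (q, 0))" unfolding cyc0[OF q(1)] using q by (auto simp: cyc_def)
      then have "c = cyc q"
        using cycle_of_eq[OF \<tau>, of i "e (q, 0)"] i(2) cyc0[OF q(1)] by simp
      then show "c \<in> cyc ` Q" using q(1) by blast
    qed
  qed
  have inj_e: "inj_on (\<lambda>k. e (q, k)) {..<snd (fst q)}" if "q \<in> Q" for q
  proof (rule inj_onI)
    fix k k' assume k: "k \<in> {..<snd (fst q)}" "k' \<in> {..<snd (fst q)}" "e (q, k) = e (q, k')"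
    then have "(q, k) \<in> E" "(q, k') \<in> E" using that by (simp_all add: E_mem)
    then show "k = k'" using inj_onD[OF bij_betw_imp_inj_on[OF e] k(3)] by simp
  qed
  have inj: "inj_on cyc Q"
  proof (rule inj_onI)
    fix q q' assume q: "q \<in> Q" "q' \<in> Q" "cyc q = cyc q'"
    have "e (q, 0) \<in> cyc q" unfolding cyc_def using len[OF q(1)] by (intro image_eqI[of _ _ 0]) simp_all
    then have "e (q, 0) \<in> cyc q'" by (simp only: q(3))
    then obtain k where k: "k < snd (fst q')" "e (q, 0) = e (q', k)" by (auto simp: cyc_def)
    have "(q, 0) \<in> E" "(q', k) \<in> E" using q(1,2) k(1) len by (simp_all add: E_mem)
    then show "q = q'" using inj_onD[OF bij_betw_imp_inj_on[OF e] k(2)] by simp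
  qed
  have type: "cycle_type r w (cyc q) = fst q" if q: "q \<in> Q" for q
  proof -
    have "card (cyc q) = snd (fst q)" unfolding cyc_def by (simp add: card_image[OF inj_e[OF q]])
    moreover have "(\<Sum>u\<in>cyc q. w u) = fst (fst q)"
    proof -
      have "(\<Sum>u\<in>cyc q. w u) = (\<Sum>k<snd (fst q). w (e (q, k)))"
        unfolding cyc_def by (simp add: sum.reindex[OF inj_e[OF q]])
      also have "\<dots> = (\<Sum>k<snd (fst q). if k = 0 then fst (fst q) else 0)"
        by (rule sum.cong) (use w_e[OF q] in auto)
      also have "\<dots> = fst (fst q)" using len[OF q] by simp
      finally show ?thesis .
    qed
    ultimately show ?thesis using col[OF q] by (simp add: cycle_type_def cycle_color_def)
  qed
  have "cyc_mult r n (w, \<tau>) t j = m (t, j)" for t j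
  proof -
    have "{c \<in> cycles \<tau> n. cycle_type r w c = (t, j)} = cyc ` {q \<in> Q. fst q = (t, j)}"
      unfolding cycles using type by auto
    then have "cyc_mult r n (w, \<tau>) t j = card {q \<in> Q. fst q = (t, j)}"
      unfolding cyc_mult_eq by (simp add: card_image inj_on_subset[OF inj])
    also have "{q \<in> Q. fst q = (t, j)} = (if (t, j) \<in> V then {(t, j)} \<times> {..<m (t, j)} else {})"
      by (auto simp: Q_def)
    also have "card \<dots> = m (t, j)" using m by (simp add: type_funs_def card_cartesian_product)
    finally show ?thesis .
  qed
  then have "(\<lambda>(t, j). cyc_mult r n (w, \<tau>) t j) = m" by (auto simp: fun_eq_iff)
  then show ?thesis using g by blast
qed

text \<open>The cycles partition \<open>{1..n}\<close>; grouping their lengths by type yields the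
  size condition.\<close>

lemma cyc_mult_in_type_funs:
  assumes g: "(w, \<tau>) \<in> Gr r n" and r: "r \<ge> 1" and V: "finite V" "{..<r} \<times> {1..n} \<subseteq> V"
  shows "(\<lambda>(t, j). cyc_mult r n (w, \<tau>) t j) \<in> type_funs V n"
proof -
  have \<tau>: "\<tau> permutes {1..n}" using g by (simp add: Gr_def)
  have ty: "cycle_type r w c \<in> V" if "c \<in> cycles \<tau> n" for c
    using cycle_type_bounds[OF \<tau> r that] V(2) by blast
  have "n = card (\<Union>(cycles \<tau> n))" by (simp add: Union_cycles[OF \<tau>])
  also have "\<dots> = (\<Sum>c\<in>cycles \<tau> n. card c)"
  proof (rule card_Union_disjoint)
    show "pairwise disjnt (cycles \<tau> n)"
      unfolding pairwise_def disjnt_def cycles_def using cycle_of_disjoint[OF \<tau>] by auto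
    show "finite c" if "c \<in> cycles \<tau> n" for c
      using that finite_cycle_of[OF \<tau>] by (auto simp: cycles_def)
  qed
  also have "\<dots> = (\<Sum>v\<in>V. \<Sum>c\<in>{c \<in> cycles \<tau> n. cycle_type r w c = v}. card c)"
    by (rule sum.group[symmetric]) (use V(1) ty finite_cycles in auto)
  also have "\<dots> = (\<Sum>v\<in>V. snd v * (case v of (t, j) \<Rightarrow> cyc_mult r n (w, \<tau>) t j))"
  proof (rule sum.cong[OF refl])
    fix v
    have "(\<Sum>c\<in>{c \<in> cycles \<tau> n. cycle_type r w c = v}. card c) =
        (\<Sum>c\<in>{c \<in> cycles \<tau> n. cycle_type r w c = v}. snd v)"
      by (rule sum.cong) (auto simp: cycle_type_def)
    then show "(\<Sum>c\<in>{c \<in> cycles \<tau> n. cycle_type r w c = v}. card c) =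
        snd v * (case v of (t, j) \<Rightarrow> cyc_mult r n (w, \<tau>) t j)"
      by (cases v) (simp add: cyc_mult_eq mult.commute)
  qed
  finally have "(\<Sum>v\<in>V. snd v * (case v of (t, j) \<Rightarrow> cyc_mult r n (w, \<tau>) t j)) = n" by simp
  moreover have "(case v of (t, j) \<Rightarrow> cyc_mult r n (w, \<tau>) t j) = 0" if "v \<notin> V" for v
  proof -
    have "(fst v, snd v) \<notin> {..<r} \<times> {1..n}" using that V(2) by auto
    from cyc_mult_eq_0[OF g r this] show ?thesis by (simp add: case_prod_unfold)
  qed
  ultimately show ?thesis unfolding type_funs_def by blast
qed

text \<open>The map \<open>T\<close> to multiplicity functions has the conjugacy classes as its
  fibres and all of \<open>type_funs V n\<close> as its image. Since the root count depends on
  \<open>T\<close> alone, the arbitrary choice of representatives is harmless.\<close>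

lemma class_sum_eq:
  assumes r: "r \<ge> 1" and V: "finite V" "{..<r} \<times> {1..n} \<subseteq> V" "V \<subseteq> {..<r} \<times> {1..}"
  shows "class_sum r n = (\<Sum>m\<in>type_funs V n. \<Prod>v\<in>V. weight r v (m v))"
proof -
  define T where "T = (\<lambda>g (t, j). cyc_mult r n g t j)"
  define cls where "cls = (\<lambda>m. {g \<in> Gr r n. T g = m})"
  have T_image: "T ` Gr r n = type_funs V n"
  proof
    show "T ` Gr r n \<subseteq> type_funs V n"
    proof (rule image_subsetI)
      fix g assume "g \<in> Gr r n"
      then show "T g \<in> type_funs V n"
        using cyc_mult_in_type_funs[OF _ r V(1,2), of "fst g" "snd g"] by (simp add: T_def)
    qed
    show "type_funs V n \<subseteq> T ` Gr r n"
    proof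
      fix m assume "m \<in> type_funs V n"
      from exists_with_cyc_mult[OF this V(1,3)] show "m \<in> T ` Gr r n"
        by (auto simp: T_def)
    qed
  qed
  have conj_iff: "(\<exists>h\<in>Gr r n. Gmult r n h g = Gmult r n g' h) \<longleftrightarrow> T g' = T g"
    if g: "g \<in> Gr r n" and g': "g' \<in> Gr r n" for g g'
  proof -
    obtain w \<tau> where wt: "g = (w, \<tau>)" by (cases g)
    obtain w' \<tau>' where wt': "g' = (w', \<tau>')" by (cases g')
    show ?thesis
    proof
      assume "\<exists>h\<in>Gr r n. Gmult r n h g = Gmult r n g' h"
      then obtain y \<rho> where "(y, \<rho>) \<in> Gr r n" "Gmult r n (y, \<rho>) g = Gmult r n g' (y, \<rho>)" by force
      then have "cyc_mult r n g t j = cyc_mult r n g' t j" for t j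
        using cyc_mult_conj[of w \<tau> r n w' \<tau>' y \<rho>] g g' by (simp add: wt wt')
      then show "T g' = T g" by (simp add: T_def fun_eq_iff)
    next
      assume e: "T g' = T g"
      have "cyc_mult r n g t j = cyc_mult r n g' t j" for t j
        using fun_cong[OF e, of "(t, j)"] by (simp add: T_def)
      then show "\<exists>h\<in>Gr r n. Gmult r n h g = Gmult r n g' h"
        using conj_if_same_cyc_mult[OF _ _ r, of w \<tau> n w' \<tau>'] g g' by (simp add: wt wt')
    qed
  qed
  have "conj_classes r n = (\<lambda>g. {g' \<in> Gr r n. \<exists>h\<in>Gr r n. Gmult r n h g = Gmult r n g' h}) ` Gr r n"
    by (auto simp: conj_classes_def)
  also have "\<dots> = (\<lambda>g. cls (T g)) ` Gr r n"
    by (rule image_cong[OF refl]) (unfold cls_def, use conj_iff in blast)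
  also have "\<dots> = cls ` type_funs V n" unfolding T_image[symmetric] image_image ..
  finally have classes: "conj_classes r n = cls ` type_funs V n" .
  have rep: "(SOME g. g \<in> cls m) \<in> cls m" if "m \<in> type_funs V n" for m
  proof -
    have "\<exists>g. g \<in> cls m" using that unfolding T_image[symmetric] by (auto simp: cls_def)
    then show ?thesis by (rule someI_ex)
  qed
  \<comment> \<open>Distinct functions have disjoint fibres, and the chosen representative shows
    that no fibre is empty.\<close>
  have "inj_on cls (type_funs V n)"
  proof (rule inj_onI)
    fix m m' assume m: "m \<in> type_funs V n" "m' \<in> type_funs V n" "cls m = cls m'"
    then show "m = m'" using rep[OF m(1)] by (auto simp: cls_def)
  qed
  then have "class_sum r n = (\<Sum>m\<in>type_funs V n. real (sqrt_count r n (SOME g. g \<in> cls m)))"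
    unfolding class_sum_def classes by (simp add: sum.reindex)
  also have "\<dots> = (\<Sum>m\<in>type_funs V n. \<Prod>v\<in>V. weight r v (m v))"
  proof (rule sum.cong[OF refl])
    fix m assume m: "m \<in> type_funs V n"
    obtain w \<tau> where g: "(SOME g. g \<in> cls m) = (w, \<tau>)" by (cases "SOME g. g \<in> cls m")
    have "(w, \<tau>) \<in> Gr r n" "T (w, \<tau>) = m" using rep[OF m] unfolding g by (auto simp: cls_def)
    moreover from this(2) have "m v = cyc_mult r n (w, \<tau>) (fst v) (snd v)" for v
      by (auto simp: T_def case_prod_unfold)
    ultimately show "real (sqrt_count r n (SOME g. g \<in> cls m)) = (\<Prod>v\<in>V. weight r v (m v))"
      unfolding g by (simp add: sqrt_count_eq_prod_weight[OF _ r V(1,2)] case_prod_unfold)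
  qed
  finally show ?thesis .
qed

theorem theorem6p6:
  fixes r :: nat
  assumes "r \<ge> 1"
  shows "(\<forall>n. \<forall>g\<in>Gr r n. \<forall>\<^sub>F K in sequentially.
            partial1 r K (cycle_monomial r n g) = real (sqrt_count r n g))
       \<and> (\<forall>n. \<forall>\<^sub>F K in sequentially.
            fps_nth (\<Prod>k\<in>{1..K}. gen_factor r k) n = class_sum r n)"
proof (intro conjI allI ballI)
  fix n g assume g: "g \<in> Gr r n"
  \<comment> \<open>Infinite products are read coefficientwise. A factor with k > n involves only
    part sizes 2k - 1 and 2k above n, so it cannot affect this coefficient.\<close>
  have "partial1 r K (cycle_monomial r n g) = real (sqrt_count r n g)" if "K \<ge> n" for K
    using partial1_cycle_monomial[of "fst g" "snd g" r n K] g assms that by simp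
  then show "\<forall>\<^sub>F K in sequentially. partial1 r K (cycle_monomial r n g) = real (sqrt_count r n g)"
    unfolding eventually_sequentially by blast
next
  fix n
  have "fps_nth (\<Prod>k\<in>{1..K}. gen_factor r k) n = class_sum r n" if "K \<ge> n" for K
    unfolding prod_gen_factor_nth
    by (rule class_sum_eq[OF assms, symmetric]) (use that in auto)
  then show "\<forall>\<^sub>F K in sequentially. fps_nth (\<Prod>k\<in>{1..K}. gen_factor r k) n = class_sum r n"
    unfolding eventually_sequentially by blast
qed

end
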